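(* Let $G$ be a finite, connected, undirected graph with at least two vertices and positive edge weights. Then $$\frac{\lambda_G}{2}\le \rho_G\le 25600\,\lambda_G.$$
   Context: For a weighted graph $H$ with edge weights $c^H_e>0$: $c^H_v:=\sum_{e\ni v}c^H_e$ is the weighted degree of $v$, and $\mathrm{vol}_H(A):=\sum_{v\in A}c^H_v$ for $A\subseteq V(H)$. For disjoint $A,B\subseteq V(H)$, $c^H(A,B)$ is the total weight of edges of $H$ with one endpoint in $A$ and one in $B$. Let $D_H$ be the diagonal degree matrix, $A_H$ the weighted adjacency matrix, $L_H:=D_H-A_H$ the Laplacian, and $N_H:=D_H^{-1/2}L_HD_H^{-1/2}$ the normalized Laplacian; $\lambda_H$ denotes the smallest nonzero eigenvalue of $N_H$. For $X\subseteq V(H)$, the Schur complement $L_H[X,X]-L_H[X,V(H)\setminus X]\,L_H[V(H)\setminus X,V(H)\setminus X]^{-1}L_H[V(H)\setminus X,X]$ is the Laplacian of an undirected weighted graph on vertex set $X$, denoted $\texttt{Schur}(H,X)$. For disjoint nonempty $A,B\subseteq V(H)$ with $I:=\texttt{Schur}(H,A\cup B)$, the Schur complement fractional conductance is $\rho^H_{A,B}:=\frac{c^I(A,B)}{\min(\mathrm{vol}_I(A),\mathrm{vol}_I(B))}$, and $\rho_H:=\min\{\rho^H_{A,B}: A,B\subseteq V(H)\text{ disjoint and nonempty}\}$. *)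

theory Defs
  imports Complex_Main
begin

text \<open>
  A weighted graph is a vertex set with a weight function on pairs of vertices;
  \<open>{u, v}\<close> is an edge, of weight \<open>weight H u v\<close>, iff \<open>weight H u v > 0\<close>.
  Loops are excluded.
\<close>

record 'a wgraph =
  verts :: "'a set"
  weight :: "'a \<Rightarrow> 'a \<Rightarrow> real"

definition weighted_graph :: "'a wgraph \<Rightarrow> bool" where
  "weighted_graph H \<longleftrightarrow>
     finite (verts H) \<and>
     (\<forall>u\<in>verts H. \<forall>v\<in>verts H. weight H u v = weight H v u) \<and>
     (\<forall>u\<in>verts H. \<forall>v\<in>verts H. 0 \<le> weight H u v) \<and>
     (\<forall>u\<in>verts H. weight H u u = 0)"

definition adj_rel :: "'a wgraph \<Rightarrow> ('a \<times> 'a) set" where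
  "adj_rel H = {(u, v). u \<in> verts H \<and> v \<in> verts H \<and> weight H u v > 0}"

definition connected_graph :: "'a wgraph \<Rightarrow> bool" where
  "connected_graph H \<longleftrightarrow> (\<forall>u\<in>verts H. \<forall>v\<in>verts H. (u, v) \<in> (adj_rel H)\<^sup>*)"

definition wdegree :: "'a wgraph \<Rightarrow> 'a \<Rightarrow> real" where
  "wdegree H v = (\<Sum>u\<in>verts H. weight H v u)"

definition vol :: "'a wgraph \<Rightarrow> 'a set \<Rightarrow> real" where
  "vol H A = (\<Sum>v\<in>A. wdegree H v)"

text \<open>Used for disjoint \<open>A\<close> and \<open>B\<close> only, so that every edge between them is counted once.\<close>

definition cut_weight :: "'a wgraph \<Rightarrow> 'a set \<Rightarrow> 'a set \<Rightarrow> real" where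
  "cut_weight H A B = (\<Sum>a\<in>A. \<Sum>b\<in>B. weight H a b)"

text \<open>
  Matrices are functions of two indices. The finite sets by which rows and columns are
  indexed are passed to the operations explicitly, so that a block \<open>M[I, J]\<close> is \<open>M\<close> itself,
  used with row indices in \<open>I\<close> and column indices in \<open>J\<close>. The first argument of \<open>mmult\<close> is the
  index set summed over.
\<close>

type_synonym 'a matr = "'a \<Rightarrow> 'a \<Rightarrow> real"

definition mmult :: "'a set \<Rightarrow> 'a matr \<Rightarrow> 'a matr \<Rightarrow> 'a matr" where
  "mmult J M N = (\<lambda>i k. \<Sum>j\<in>J. M i j * N j k)"

definition mdiag :: "('a \<Rightarrow> real) \<Rightarrow> 'a matr" where
  "mdiag d = (\<lambda>i j. if i = j then d i else 0)"

definition is_block_inverse :: "'a set \<Rightarrow> 'a matr \<Rightarrow> 'a matr \<Rightarrow> bool" where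
  "is_block_inverse J M N \<longleftrightarrow>
     (\<forall>i\<in>J. \<forall>j\<in>J. mmult J M N i j = mdiag (\<lambda>_. 1) i j \<and>
                  mmult J N M i j = mdiag (\<lambda>_. 1) i j)"

text \<open>
  The inverse of \<open>M[J, J]\<close>. It is fixed to be zero outside \<open>J \<times> J\<close>, which makes it unique
  as a function.
\<close>

definition block_inverse :: "'a set \<Rightarrow> 'a matr \<Rightarrow> 'a matr" where
  "block_inverse J M =
     (THE N. is_block_inverse J M N \<and> (\<forall>i j. i \<notin> J \<or> j \<notin> J \<longrightarrow> N i j = 0))"

definition is_eigenvalue :: "'a set \<Rightarrow> 'a matr \<Rightarrow> real \<Rightarrow> bool" where
  "is_eigenvalue J M \<mu> \<longleftrightarrow>
     (\<exists>x. (\<exists>i\<in>J. x i \<noteq> 0) \<and> (\<forall>i\<in>J. (\<Sum>j\<in>J. M i j * x j) = \<mu> * x i))"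

definition laplacian :: "'a wgraph \<Rightarrow> 'a matr" where
  "laplacian H = (\<lambda>u v. mdiag (wdegree H) u v - weight H u v)"

definition normalized_laplacian :: "'a wgraph \<Rightarrow> 'a matr" where
  "normalized_laplacian H =
     (let R = mdiag (\<lambda>v. 1 / sqrt (wdegree H v))
      in mmult (verts H) (mmult (verts H) R (laplacian H)) R)"

definition lambda_graph :: "'a wgraph \<Rightarrow> real" where
  "lambda_graph H =
     Min {\<mu>. is_eigenvalue (verts H) (normalized_laplacian H) \<mu> \<and> \<mu> \<noteq> 0}"

definition schur_complement :: "'a wgraph \<Rightarrow> 'a set \<Rightarrow> 'a matr" where
  "schur_complement H X =
     (let L = laplacian H; Y = verts H - X
      in (\<lambda>u v. L u v - mmult Y (mmult Y L (block_inverse Y L)) L u v))"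

text \<open>The graph on \<open>X\<close> whose Laplacian is the Schur complement.\<close>

definition schur_graph :: "'a wgraph \<Rightarrow> 'a set \<Rightarrow> 'a wgraph" where
  "schur_graph H X =
     \<lparr>verts = X, weight = (\<lambda>u v. if u = v then 0 else - schur_complement H X u v)\<rparr>"

definition rho_pair :: "'a wgraph \<Rightarrow> 'a set \<Rightarrow> 'a set \<Rightarrow> real" where
  "rho_pair H A B =
     (let I = schur_graph H (A \<union> B)
      in cut_weight I A B / min (vol I A) (vol I B))"

definition rho_graph :: "'a wgraph \<Rightarrow> real" where
  "rho_graph H =
     Min {rho_pair H A B | A B.
       A \<subseteq> verts H \<and> B \<subseteq> verts H \<and> A \<inter> B = {} \<and> A \<noteq> {} \<and> B \<noteq> {}}"

end

theory Submission
  imports Defs "HOL-Analysis.Analysis"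
begin

text \<open>
  By the Dirichlet principle, the cut weight of \<open>A\<close> and \<open>B\<close> in the Schur complement graph is the least
  energy of a function that is \<open>1\<close> on \<open>A\<close> and \<open>0\<close> on \<open>B\<close>, and the degree of \<open>a\<close> is the least energy of a
  function that is \<open>1\<close> at \<open>a\<close> and \<open>0\<close> on the rest of \<open>A \<union> B\<close>. In particular that degree is at most the
  degree of \<open>a\<close> in \<open>G\<close>, and at least the weight of the edges of \<open>G\<close> from \<open>a\<close> into \<open>A \<union> B\<close>.

  Lower bound: apply the Poincare inequality of \<open>G\<close> to the harmonic extension of the indicator
  function of \<open>A\<close>.

  Upper bound: let \<open>g\<close> be the positive part of an eigenfunction, with the sign chosen such that the
  support of \<open>g\<close> has at most half of the volume. For \<open>t > 0\<close> put \<open>A = {g \<ge> t}\<close> and \<open>B = {g \<le> t / 2}\<close>.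
  Integrated against \<open>t dt\<close>, the cut weights are bounded by a constant times the energy of \<open>g\<close>, hence by
  a constant times \<open>\<lambda> \<Sum> c g\<^sup>2\<close>. The volumes lose at most the weight of the edges that leave a level set
  of \<open>g\<close>, in total \<open>O(\<surd>\<lambda>) \<Sum> c g\<^sup>2\<close>, so for small \<open>\<lambda>\<close> they still integrate to a constant times \<open>\<Sum> c g\<^sup>2\<close>,
  and some \<open>t\<close> gives a ratio \<open>O(\<lambda>)\<close>. For large \<open>\<lambda>\<close> two single vertices, with ratio \<open>1\<close>, suffice.
\<close>

subsection \<open>Matrices and real functions\<close>

text \<open>Bordering: enlarging the block by \<open>y\<close> leaves one scalar equation with pivot
  \<open>d\<close>, and \<open>d = 0\<close> would give a kernel vector with entry 1 at
  \<open>y\<close>. Injectivity is assumed for every principal block so that the induction inherits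
  the hypothesis.\<close>

lemma exists_solution_if_injective:
  fixes M :: "'a matr" and b :: "'a \<Rightarrow> real"
  assumes "finite Y"
    and "\<And>Z f. Z \<subseteq> Y \<Longrightarrow> \<forall>i\<in>Z. (\<Sum>j\<in>Z. M i j * f j) = 0 \<Longrightarrow> \<forall>i\<in>Z. f i = 0"
  shows "\<exists>f. \<forall>i\<in>Y. (\<Sum>j\<in>Y. M i j * f j) = b i"
  using assms
proof (induction Y arbitrary: b rule: finite_induct)
  case empty
  then show ?case by simp
next
  case (insert y Y)
  have inj: "\<forall>i\<in>Z. f i = 0" if "Z \<subseteq> Y" "\<forall>i\<in>Z. (\<Sum>j\<in>Z. M i j * f j) = 0" for Z f
    using insert.prems[of Z f] that by blast
  obtain g where g: "\<forall>i\<in>Y. (\<Sum>j\<in>Y. M i j * g j) = b i"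
    using insert.IH[OF inj, of b] by blast
  obtain p where p: "\<forall>i\<in>Y. (\<Sum>j\<in>Y. M i j * p j) = M i y"
    using insert.IH[OF inj, of "\<lambda>i. M i y"] by blast
  have split: "(\<Sum>j\<in>insert y Y. M i j * (if j = y then s else h j)) = M i y * s + (\<Sum>j\<in>Y. M i j * h j)"
    for i s h
  proof -
    have "(\<Sum>j\<in>Y. M i j * (if j = y then s else h j)) = (\<Sum>j\<in>Y. M i j * h j)"
      using insert.hyps by (intro sum.cong) auto
    then show ?thesis using insert.hyps by simp
  qed
  define d where "d = M y y - (\<Sum>j\<in>Y. M y j * p j)"
  have d: "d \<noteq> 0"
  proof
    assume "d = 0"
    then have "\<forall>i\<in>insert y Y. (\<Sum>j\<in>insert y Y. M i j * (if j = y then 1 else - p j)) = 0"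
      unfolding split using p by (simp add: d_def sum_negf)
    from insert.prems[OF subset_refl this] show False by auto
  qed
  define s where "s = (b y - (\<Sum>j\<in>Y. M y j * g j)) / d"
  have dist: "(\<Sum>j\<in>Y. M i j * (g j - s * p j)) = (\<Sum>j\<in>Y. M i j * g j) - s * (\<Sum>j\<in>Y. M i j * p j)" for i
    by (simp add: sum_subtractf algebra_simps sum_distrib_left)
  have sd: "s * M y y - s * (\<Sum>j\<in>Y. M y j * p j) = b y - (\<Sum>j\<in>Y. M y j * g j)"
    using d unfolding s_def right_diff_distrib[symmetric] d_def by simp
  have "\<forall>i\<in>insert y Y. (\<Sum>j\<in>insert y Y. M i j * (if j = y then s else g j - s * p j)) = b i"
    unfolding split dist using g p sd by (auto simp: algebra_simps)
  then show ?case by (rule exI[where x = "\<lambda>j. if j = y then s else g j - s * p j"])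
qed

text \<open>Solving for the unit vectors gives a right inverse \<open>N\<close>. Injectivity makes
  it a left inverse and the only candidate vanishing off the block, so the \<open>THE\<close> in
  \<open>block_inverse\<close> is well defined.\<close>

lemma block_inverse_is_inverse:
  fixes M :: "'a matr"
  assumes fin: "finite Y"
    and inj: "\<And>Z f. Z \<subseteq> Y \<Longrightarrow> \<forall>i\<in>Z. (\<Sum>j\<in>Z. M i j * f j) = 0 \<Longrightarrow> \<forall>i\<in>Z. f i = 0"
  shows "is_block_inverse Y M (block_inverse Y M)"
proof -
  define F where "F k = (SOME f. \<forall>i\<in>Y. (\<Sum>j\<in>Y. M i j * f j) = mdiag (\<lambda>_. 1) i k)" for k
  have F: "(\<Sum>j\<in>Y. M i j * F k j) = mdiag (\<lambda>_. 1) i k" if "i \<in> Y" for i k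
    using someI_ex[OF exists_solution_if_injective[OF assms, where b = "\<lambda>i. mdiag (\<lambda>_. 1) i k"]] that
    unfolding F_def by blast
  define N where "N = (\<lambda>i k. if i \<in> Y \<and> k \<in> Y then F k i else 0)"
  have right: "mmult Y M N i k = mdiag (\<lambda>_. 1) i k" if "i \<in> Y" "k \<in> Y" for i k
    using F[OF that(1), of k] that by (simp add: mmult_def N_def cong: sum.cong)
  have left: "mmult Y N M i k = mdiag (\<lambda>_. 1) i k" if "i \<in> Y" "k \<in> Y" for i k
  proof -
    \<comment> \<open>\<open>M (N M - 1) = (M N) M - M = 0\<close>, so the columns of
      \<open>N M - 1\<close> lie in the trivial kernel.\<close>
    have "(\<Sum>j\<in>Y. M i' j * (mmult Y N M j k - mdiag (\<lambda>_. 1) j k)) = 0" if "i' \<in> Y" for i'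
    proof -
      have "(\<Sum>j\<in>Y. M i' j * mmult Y N M j k) = (\<Sum>l\<in>Y. mmult Y M N i' l * M l k)"
        unfolding mmult_def sum_distrib_left sum_distrib_right
        by (subst sum.swap) (simp add: mult.assoc)
      also have "\<dots> = (\<Sum>l\<in>Y. if i' = l then M l k else 0)"
        using right that by (intro sum.cong) (auto simp: mdiag_def)
      also have "\<dots> = M i' k" using fin that by simp
      moreover have "(\<Sum>j\<in>Y. M i' j * mdiag (\<lambda>_. 1) j k) = M i' k"
        using fin \<open>k \<in> Y\<close> by (simp add: mdiag_def if_distrib cong: if_cong)
      ultimately show ?thesis by (simp add: right_diff_distrib sum_subtractf)
    qed
    then have "\<forall>j\<in>Y. mmult Y N M j k - mdiag (\<lambda>_. 1) j k = 0"
      using inj[OF subset_refl, of "\<lambda>j. mmult Y N M j k - mdiag (\<lambda>_. 1) j k"] by blast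
    then show ?thesis using that by auto
  qed
  have "is_block_inverse Y M N \<and> (\<forall>i j. i \<notin> Y \<or> j \<notin> Y \<longrightarrow> N i j = 0)"
    using left right by (auto simp: is_block_inverse_def N_def)
  moreover have "N' = N"
    if N': "is_block_inverse Y M N' \<and> (\<forall>i j. i \<notin> Y \<or> j \<notin> Y \<longrightarrow> N' i j = 0)" for N'
  proof (intro ext)
    fix i k
    show "N' i k = N i k"
    proof (cases "i \<in> Y \<and> k \<in> Y")
      case True
      then have "\<forall>i\<in>Y. (\<Sum>j\<in>Y. M i j * (N' j k - N j k)) = 0"
        using N' right by (auto simp: is_block_inverse_def mmult_def right_diff_distrib sum_subtractf)
      from inj[OF subset_refl this] show ?thesis using True by auto
    next
      case False
      then show ?thesis using N' by (auto simp: N_def)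
    qed
  qed
  ultimately show ?thesis
    unfolding block_inverse_def by (rule theI2[where a = N]) blast+
qed

section \<open>Real analysis for the first variation and for the sweep\<close>

lemma linear_coeff_zero:
  fixes a b :: real
  assumes "\<And>s. 0 \<le> 2 * s * a + s\<^sup>2 * b"
  shows "a = 0"
proof (rule ccontr)
  assume "a \<noteq> 0"
  \<comment> \<open>\<open>B\<close> is positive and exceeds \<open>b\<close> whatever the sign of
    \<open>b\<close>, so at \<open>s = - a / B\<close> the linear term outweighs the quadratic
    one.\<close>
  define B where "B = \<bar>b\<bar> + 1"
  have B: "0 < B" "b < B" by (auto simp: B_def)
  have "2 * (- a / B) * a + (- a / B)\<^sup>2 * b = a\<^sup>2 / B * (b / B - 2)"
    using B by (simp add: power2_eq_square field_simps)
  also have "\<dots> < 0"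
    using B \<open>a \<noteq> 0\<close> by (intro mult_pos_neg) (simp_all add: field_simps)
  finally show False using assms[of "- a / B"] by simp
qed

text \<open>Stated over the whole line, empty intervals included, so that integrands supported on
  different intervals can be added and compared.\<close>

lemma has_integral_id_indicator:
  fixes a b :: real
  shows "((\<lambda>t. if t \<in> {a..b} then t else 0) has_integral (if a \<le> b then (b\<^sup>2 - a\<^sup>2) / 2 else 0)) UNIV"
proof (cases "a \<le> b")
  case True
  then show ?thesis unfolding has_integral_restrict_UNIV using ident_has_integral[OF True] by simp
next
  case False
  then have "(\<lambda>t. if t \<in> {a..b} then t else 0) = (\<lambda>_. 0)" by auto
  then show ?thesis using False by simp
qed

text \<open>Cuts \<open>z\<close> off below \<open>t / 2\<close> and above \<open>t\<close> and rescales to \<open>[0, 1]\<close>, so that composition with \<open>g\<close>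
  gives a test function for the level sets \<open>{g \<ge> t}\<close> and \<open>{g \<le> t / 2}\<close>.\<close>

definition ramp :: "real \<Rightarrow> real \<Rightarrow> real" where
  "ramp t z = min 1 (max 0 (2 * z / t - 1))"

lemma ramp_eq_1: "0 < t \<Longrightarrow> t \<le> z \<Longrightarrow> ramp t z = 1"
  and ramp_eq_0: "0 < t \<Longrightarrow> z \<le> t / 2 \<Longrightarrow> ramp t z = 0"
  by (auto simp: ramp_def min_def max_def field_simps)

text \<open>An explicit majorant replaces the exact piecewise integral. If
  \<open>x \<le> 2 * y\<close>, the difference vanishes outside \<open>[y, 2 x]\<close> and is at
  most \<open>2 (x - y) / t\<close>. Otherwise \<open>x < 2 (x - y)\<close>, and the trivial bound 1
  on \<open>[0, 2 x]\<close> suffices.\<close>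

lemma ramp_diff_majorant_ordered:
  fixes x y :: real
  assumes "0 \<le> y" "y \<le> x"
  shows "\<exists>U I. (U has_integral I) UNIV \<and> I \<le> 12 * (x - y)\<^sup>2 \<and> (\<forall>t. 0 \<le> U t) \<and>
    (\<forall>t>0. t * (ramp t x - ramp t y)\<^sup>2 \<le> U t)"
proof (cases "x \<le> 2 * y")
  case True
  show ?thesis
  proof (cases "y = 0")
    case True
    with \<open>x \<le> 2 * y\<close> assms have "x = y" by simp
    then show ?thesis by (intro exI[of _ "\<lambda>_. 0"] exI[of _ 0]) auto
  next
    case False
    then have y: "0 < y" using assms by simp
    define U where "U t = (if t \<in> {y..2 * x} then 4 * (x - y)\<^sup>2 / y else 0)" for t
    have "(U has_integral ((2 * x - y) *\<^sub>R (4 * (x - y)\<^sup>2 / y))) UNIV"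
      unfolding U_def has_integral_restrict_UNIV using has_integral_const_real[of "4 * (x - y)\<^sup>2 / y" y "2 * x"] assms
      by simp
    moreover have "(2 * x - y) *\<^sub>R (4 * (x - y)\<^sup>2 / y) \<le> 12 * (x - y)\<^sup>2"
    proof -
      \<comment> \<open>By \<open>x \<le> 2 * y\<close> the interval has length at most
        \<open>3 * y\<close>, whence \<open>12 = 3 * 4\<close>.\<close>
      have "(2 * x - y) / y * (4 * (x - y)\<^sup>2) \<le> 3 * (4 * (x - y)\<^sup>2)"
        using True y by (intro mult_right_mono) (auto simp: field_simps)
      then show ?thesis by simp
    qed
    moreover have "0 \<le> U t" for t using y by (simp add: U_def)
    moreover have "t * (ramp t x - ramp t y)\<^sup>2 \<le> U t" if t: "0 < t" for t
    proof (cases "t \<in> {y..2 * x}")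
      case True
      have "\<bar>ramp t x - ramp t y\<bar> \<le> \<bar>2 * x / t - 2 * y / t\<bar>"
        unfolding ramp_def by linarith
      also have "\<dots> = 2 * (x - y) / t"
        using t assms by (simp add: diff_divide_distrib[symmetric] abs_of_nonneg)
      finally have "(ramp t x - ramp t y)\<^sup>2 \<le> (2 * (x - y) / t)\<^sup>2"
        by (metis abs_ge_zero power2_abs power_mono)
      then have "t * (ramp t x - ramp t y)\<^sup>2 \<le> t * (2 * (x - y) / t)\<^sup>2"
        using t by simp
      also have "\<dots> = 4 * (x - y)\<^sup>2 / t"
        using t by (simp add: power2_eq_square field_simps)
      also have "\<dots> \<le> 4 * (x - y)\<^sup>2 / y"
        using True y by (intro divide_left_mono) auto
      finally show ?thesis using True by (simp add: U_def)
    next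
      case False
      then have "t < y \<or> 2 * x < t" by auto
      \<comment> \<open>Both ramps are 1 for \<open>t < y\<close> and 0 for
        \<open>2 * x < t\<close>.\<close>
      then have "ramp t x = ramp t y"
        using t assms by (auto simp: ramp_eq_1 ramp_eq_0)
      then show ?thesis using y by (simp add: U_def)
    qed
    ultimately show ?thesis by blast
  qed
next
  case False
  define U where "U t = (if t \<in> {0..2 * x} then t else 0)" for t
  have "(U has_integral ((2 * x)\<^sup>2 - 0\<^sup>2) / 2) UNIV"
    using has_integral_id_indicator[of 0 "2 * x"] assms by (simp add: U_def[abs_def])
  moreover have "((2 * x)\<^sup>2 - 0\<^sup>2) / 2 \<le> 12 * (x - y)\<^sup>2"
  proof -
    have "(x / 2)\<^sup>2 \<le> (x - y)\<^sup>2" using False assms by (intro power_mono) auto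
    then have "x\<^sup>2 \<le> 4 * (x - y)\<^sup>2" by (simp add: power_divide)
    moreover have "((2 * x)\<^sup>2 - 0\<^sup>2) / 2 = 2 * x\<^sup>2" by (simp add: power_mult_distrib)
    ultimately show ?thesis using zero_le_power2[of "x - y"] by linarith
  qed
  moreover have "0 \<le> U t" for t by (simp add: U_def)
  moreover have "t * (ramp t x - ramp t y)\<^sup>2 \<le> U t" if t: "0 < t" for t
  proof (cases "t \<le> 2 * x")
    case True
    have "\<bar>ramp t x - ramp t y\<bar> \<le> 1" by (auto simp: ramp_def min_def max_def)
    then have "(ramp t x - ramp t y)\<^sup>2 \<le> 1" by (simp add: abs_square_le_1)
    then show ?thesis using True t by (simp add: U_def mult_left_le)
  next
    case False
    then show ?thesis using t assms by (simp add: ramp_eq_0 U_def)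
  qed
  ultimately show ?thesis by blast
qed

lemma ramp_diff_majorant:
  fixes x y :: real
  assumes "0 \<le> x" "0 \<le> y"
  shows "\<exists>U I. (U has_integral I) UNIV \<and> I \<le> 12 * (x - y)\<^sup>2 \<and> (\<forall>t. 0 \<le> U t) \<and>
    (\<forall>t>0. t * (ramp t x - ramp t y)\<^sup>2 \<le> U t)"
proof (cases "y \<le> x")
  case True
  then show ?thesis using ramp_diff_majorant_ordered assms by blast
next
  case False
  then show ?thesis using ramp_diff_majorant_ordered[of x y] assms
    by (simp add: power2_commute[of x y] power2_commute[of "ramp _ x"])
qed

text \<open>Weighted AM-GM for the factors \<open>x - y\<close> and \<open>x + y\<close>. The weight
  40 keeps the coefficient of the squares small enough to be absorbed in the sweep.\<close>

lemma square_diff_bound: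
  fixes x y :: real
  shows "\<bar>x\<^sup>2 - y\<^sup>2\<bar> \<le> 20 * (x - y)\<^sup>2 + (x\<^sup>2 + y\<^sup>2) / 40"
proof -
  have "0 \<le> (40 * \<bar>x - y\<bar> - \<bar>x + y\<bar>)\<^sup>2" by simp
  then have "80 * (\<bar>x - y\<bar> * \<bar>x + y\<bar>) \<le> 1600 * (x - y)\<^sup>2 + (x + y)\<^sup>2"
    by (simp add: power2_diff power_mult_distrib)
  moreover have "\<bar>x - y\<bar> * \<bar>x + y\<bar> = \<bar>x\<^sup>2 - y\<^sup>2\<bar>"
    by (simp add: abs_mult[symmetric] power2_eq_square algebra_simps)
  moreover have "(x + y)\<^sup>2 \<le> 2 * (x\<^sup>2 + y\<^sup>2)"
    using sum_squares_bound[of x y] by (simp add: power2_sum)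
  ultimately show ?thesis by linarith
qed

subsection \<open>Dirichlet form\<close>

locale connected_weighted_graph =
  fixes G :: "'a wgraph"
  assumes weighted: "weighted_graph G"
    and connected: "connected_graph G"
    and card_verts: "card (verts G) \<ge> 2"
begin

abbreviation "V \<equiv> verts G"
abbreviation "w \<equiv> weight G"
abbreviation "c \<equiv> wdegree G"

lemma finite_V [simp]: "finite V"
  and w_sym: "u \<in> V \<Longrightarrow> v \<in> V \<Longrightarrow> w u v = w v u"
  and w_nonneg: "u \<in> V \<Longrightarrow> v \<in> V \<Longrightarrow> 0 \<le> w u v"
  and w_loop: "u \<in> V \<Longrightarrow> w u u = 0"
  using weighted by (auto simp: weighted_graph_def)

definition lap :: "('a \<Rightarrow> real) \<Rightarrow> 'a \<Rightarrow> real" where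
  "lap f u = (\<Sum>v\<in>V. w u v * (f u - f v))"

text \<open>Halved because the sum runs over ordered pairs, so that each edge counts once.\<close>

definition dform :: "('a \<Rightarrow> real) \<Rightarrow> ('a \<Rightarrow> real) \<Rightarrow> real" where
  "dform f g = (\<Sum>u\<in>V. \<Sum>v\<in>V. w u v * ((f u - f v) * (g u - g v))) / 2"

abbreviation energy :: "('a \<Rightarrow> real) \<Rightarrow> real" where
  "energy f \<equiv> dform f f"

lemma laplacian_apply:
  assumes "u \<in> V"
  shows "(\<Sum>v\<in>V. laplacian G u v * f v) = lap f u"
proof -
  have "(\<Sum>v\<in>V. laplacian G u v * f v) = (\<Sum>v\<in>V. mdiag c u v * f v) - (\<Sum>v\<in>V. w u v * f v)"
    by (simp add: laplacian_def left_diff_distrib sum_subtractf)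
  also have "(\<Sum>v\<in>V. mdiag c u v * f v) = (\<Sum>v\<in>V. if u = v then c u * f u else 0)"
    by (intro sum.cong) (auto simp: mdiag_def)
  also have "\<dots> = c u * f u" using assms by simp
  finally show ?thesis
    by (simp add: lap_def wdegree_def right_diff_distrib sum_subtractf sum_distrib_right)
qed

text \<open>Summation by parts: exchanging \<open>u\<close> and \<open>v\<close> shows that the
  terms with \<open>f u\<close> and those with \<open>f v\<close> have equal sums.\<close>

lemma dform_eq_sum_lap: "dform f g = (\<Sum>u\<in>V. f u * lap g u)"
proof -
  let ?S = "\<Sum>u\<in>V. \<Sum>v\<in>V. w u v * (f u * (g u - g v))"
  have "(\<Sum>u\<in>V. \<Sum>v\<in>V. w u v * (f v * (g v - g u))) = ?S"
    by (subst sum.swap) (auto intro!: sum.cong simp: w_sym)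
  moreover have "(\<Sum>u\<in>V. \<Sum>v\<in>V. w u v * ((f u - f v) * (g u - g v)))
      = ?S + (\<Sum>u\<in>V. \<Sum>v\<in>V. w u v * (f v * (g v - g u)))"
    unfolding sum.distrib[symmetric] by (intro sum.cong) (auto simp: algebra_simps)
  moreover have "?S = (\<Sum>u\<in>V. f u * lap g u)"
    unfolding lap_def sum_distrib_left by (intro sum.cong) auto
  ultimately show ?thesis by (simp add: dform_def)
qed

lemma dform_commute: "dform f g = dform g f"
  by (simp add: dform_def mult.commute)

lemma energy_add_scaled:
  "energy (\<lambda>v. f v + s * g v) = energy f + 2 * s * dform f g + s\<^sup>2 * energy g"
proof -
  have "(\<Sum>u\<in>V. \<Sum>v\<in>V. w u v * ((f u + s * g u - (f v + s * g v)) * (f u + s * g u - (f v + s * g v))))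
     = (\<Sum>u\<in>V. \<Sum>v\<in>V. w u v * ((f u - f v) * (f u - f v)))
     + 2 * s * (\<Sum>u\<in>V. \<Sum>v\<in>V. w u v * ((f u - f v) * (g u - g v)))
     + s\<^sup>2 * (\<Sum>u\<in>V. \<Sum>v\<in>V. w u v * ((g u - g v) * (g u - g v)))"
    unfolding sum_distrib_left sum.distrib[symmetric]
    by (intro sum.cong refl) (simp add: algebra_simps power2_eq_square)
  then show ?thesis by (simp add: dform_def)
qed

lemma energy_eq: "energy f = (\<Sum>u\<in>V. \<Sum>v\<in>V. w u v * (f u - f v)\<^sup>2) / 2"
  by (simp add: dform_def power2_eq_square)

lemma energy_nonneg: "0 \<le> energy f"
  unfolding energy_eq by (auto intro!: sum_nonneg mult_nonneg_nonneg simp: w_nonneg)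

text \<open>All terms of the energy are nonnegative, so \<open>f\<close> agrees across every edge
  and hence along paths. This is where connectivity enters.\<close>

lemma energy_zero_imp_const:
  assumes "energy f = 0" "u \<in> V" "v \<in> V"
  shows "f u = f v"
proof -
  have "(\<Sum>u\<in>V. \<Sum>v\<in>V. w u v * (f u - f v)\<^sup>2) = 0"
    using assms(1) by (simp add: energy_eq)
  then have inner: "\<forall>u\<in>V. (\<Sum>v\<in>V. w u v * (f u - f v)\<^sup>2) = 0"
    by (subst (asm) sum_nonneg_eq_0_iff) (auto intro!: sum_nonneg simp: w_nonneg)
  have *: "w u v * (f u - f v)\<^sup>2 = 0" if "u \<in> V" "v \<in> V" for u v
    using inner[rule_format, OF that(1)] that
    by (subst (asm) sum_nonneg_eq_0_iff) (auto simp: w_nonneg)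
  have "(u, v) \<in> (adj_rel G)\<^sup>*" using connected assms by (auto simp: connected_graph_def)
  then show ?thesis
  proof (induction rule: rtrancl_induct)
    case (step y z)
    then have "f y = f z" using * by (fastforce simp: adj_rel_def)
    with step show ?case by simp
  qed simp
qed

lemma energy_pos:
  assumes "u \<in> V" "v \<in> V" "f u \<noteq> f v"
  shows "0 < energy f"
  using energy_zero_imp_const[of f u v] energy_nonneg[of f] assms by fastforce

lemma lap_const:
  assumes "\<And>u v. u \<in> V \<Longrightarrow> v \<in> V \<Longrightarrow> f u = f v" "u \<in> V"
  shows "lap f u = 0"
  unfolding lap_def
proof (intro sum.neutral ballI)
  fix v assume "v \<in> V"
  then show "w u v * (f u - f v) = 0" using assms(1)[OF assms(2), of v] by simp
qed

lemma exists_other: "\<exists>v\<in>V. v \<noteq> u"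
proof (rule ccontr)
  assume "\<not> ?thesis"
  then have "V \<subseteq> {u}" by blast
  then have "card V \<le> 1" using card_mono[of "{u}" V] by simp
  then show False using card_verts by simp
qed

lemma lap_delta:
  assumes "u \<in> V"
  shows "lap (\<lambda>v. if v = u then 1 else 0) u = c u"
  using assms unfolding lap_def wdegree_def
  by (intro sum.cong) (auto simp: w_loop)

lemma energy_delta:
  assumes "u \<in> V"
  shows "energy (\<lambda>v. if v = u then 1 else 0) = c u"
  unfolding dform_eq_sum_lap using lap_delta[OF assms] assms
  by (simp add: if_distrib[of "\<lambda>z. z * _"] cong: if_cong)

text \<open>The degree is the energy of a point indicator, which is not constant because there is a
  second vertex.\<close>

lemma c_pos:
  assumes "u \<in> V"
  shows "0 < c u"
proof -
  obtain v where "v \<in> V" "v \<noteq> u" using exists_other by blast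
  then show ?thesis
    using energy_pos[of u v "\<lambda>v. if v = u then 1 else 0"] assms by (simp add: energy_delta)
qed

text \<open>Extended by zero, \<open>f\<close> has energy zero and is thus constant; it vanishes at
  a vertex outside the proper subset \<open>Z\<close>.\<close>

lemma laplacian_block_injective:
  assumes "Z \<subset> V" "\<forall>i\<in>Z. (\<Sum>j\<in>Z. laplacian G i j * f j) = 0"
  shows "\<forall>i\<in>Z. f i = 0"
proof -
  define g where "g = (\<lambda>v. if v \<in> Z then f v else 0)"
  have "lap g i = 0" if "i \<in> Z" for i
  proof -
    have "lap g i = (\<Sum>j\<in>V. laplacian G i j * g j)"
      using that assms by (subst laplacian_apply) auto
    also have "\<dots> = (\<Sum>j\<in>Z. laplacian G i j * f j)"
      using assms(1) by (intro sum.mono_neutral_cong_right) (auto simp: g_def)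
    finally show ?thesis using assms that by simp
  qed
  then have "energy g = 0"
    unfolding dform_eq_sum_lap by (intro sum.neutral) (auto simp: g_def)
  moreover obtain v where "v \<in> V" "v \<notin> Z" using assms(1) by blast
  ultimately have "g i = 0" if "i \<in> Z" for i
    using energy_zero_imp_const[of g i v] that assms(1) by (auto simp: g_def)
  then show ?thesis by (auto simp: g_def)
qed

subsection \<open>Schur complements\<close>

text \<open>Off \<open>X\<close> this is \<open>- L[Y, Y]^-1 L[Y, X] u\<close> with
  \<open>Y = V - X\<close>, the solution of the Dirichlet problem with boundary values
  \<open>u\<close> on \<open>X\<close>.\<close>

definition harmonic_ext :: "'a set \<Rightarrow> ('a \<Rightarrow> real) \<Rightarrow> 'a \<Rightarrow> real" where
  "harmonic_ext X u v = (if v \<in> X then u v else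
     - (\<Sum>y\<in>V - X. block_inverse (V - X) (laplacian G) v y * (\<Sum>x\<in>X. laplacian G y x * u x)))"

context
  fixes X assumes X: "X \<subseteq> V" "X \<noteq> {}"
begin

lemma block_inverse_laplacian:
  "is_block_inverse (V - X) (laplacian G) (block_inverse (V - X) (laplacian G))"
proof (rule block_inverse_is_inverse)
  fix Z f assume "Z \<subseteq> V - X" "\<forall>i\<in>Z. (\<Sum>j\<in>Z. laplacian G i j * f j) = 0"
  moreover from this X have "Z \<subset> V" by blast
  ultimately show "\<forall>i\<in>Z. f i = 0" using laplacian_block_injective by blast
qed simp

text \<open>Common source of two facts: for \<open>v\<close> outside \<open>X\<close> the inner
  product of matrices is the identity and everything cancels; for \<open>v\<close> in
  \<open>X\<close> the second sum is the correction term of the Schur complement.\<close>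

lemma lap_harmonic_ext_split:
  assumes "v \<in> V"
  shows "lap (harmonic_ext X u) v = (\<Sum>x\<in>X. laplacian G v x * u x)
     - (\<Sum>y\<in>V - X. mmult (V - X) (laplacian G) (block_inverse (V - X) (laplacian G)) v y
          * (\<Sum>x\<in>X. laplacian G y x * u x))"
proof -
  let ?Y = "V - X" let ?L = "laplacian G" let ?N = "block_inverse ?Y ?L"
  let ?h = "harmonic_ext X u"
  have "lap ?h v = (\<Sum>j\<in>V. ?L v j * ?h j)"
    using assms by (simp add: laplacian_apply)
  also have "\<dots> = (\<Sum>j\<in>X. ?L v j * ?h j) + (\<Sum>j\<in>?Y. ?L v j * ?h j)"
    using X by (subst sum.subset_diff[of X V]) auto
  also have "(\<Sum>j\<in>X. ?L v j * ?h j) = (\<Sum>j\<in>X. ?L v j * u j)"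
    by (intro sum.cong) (auto simp: harmonic_ext_def)
  also have "(\<Sum>j\<in>?Y. ?L v j * ?h j) = - (\<Sum>j\<in>?Y. \<Sum>y\<in>?Y. ?L v j * ?N j y * (\<Sum>x\<in>X. ?L y x * u x))"
    unfolding sum_negf[symmetric]
    by (intro sum.cong) (auto simp: harmonic_ext_def sum_distrib_left mult.assoc sum_negf)
  also have "(\<Sum>j\<in>?Y. \<Sum>y\<in>?Y. ?L v j * ?N j y * (\<Sum>x\<in>X. ?L y x * u x))
     = (\<Sum>y\<in>?Y. mmult ?Y ?L ?N v y * (\<Sum>x\<in>X. ?L y x * u x))"
    by (subst sum.swap) (simp add: mmult_def sum_distrib_right)
  finally show ?thesis by simp
qed

lemma lap_harmonic_ext_outside:
  assumes "v \<in> V - X"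
  shows "lap (harmonic_ext X u) v = 0"
proof -
  let ?Y = "V - X" let ?L = "laplacian G" let ?N = "block_inverse ?Y ?L"
  let ?b = "\<lambda>y. \<Sum>x\<in>X. ?L y x * u x"
  have "(\<Sum>y\<in>?Y. mmult ?Y ?L ?N v y * ?b y) = (\<Sum>y\<in>?Y. if v = y then ?b v else 0)"
    using block_inverse_laplacian assms
    by (intro sum.cong) (auto simp: is_block_inverse_def mdiag_def)
  also have "\<dots> = ?b v" using assms by simp
  finally show ?thesis using assms by (simp add: lap_harmonic_ext_split)
qed

lemma lap_harmonic_ext_inside:
  assumes "v \<in> X"
  shows "lap (harmonic_ext X u) v = (\<Sum>x\<in>X. schur_complement G X v x * u x)"
proof -
  let ?Y = "V - X" let ?L = "laplacian G" let ?N = "block_inverse ?Y ?L"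
  have "(\<Sum>y\<in>?Y. mmult ?Y ?L ?N v y * (\<Sum>x\<in>X. ?L y x * u x))
     = (\<Sum>x\<in>X. mmult ?Y (mmult ?Y ?L ?N) ?L v x * u x)"
    unfolding mmult_def[of ?Y "mmult ?Y ?L ?N"] sum_distrib_left sum_distrib_right
    by (subst sum.swap) (simp add: mult.assoc)
  moreover have "v \<in> V" using assms X by blast
  ultimately show ?thesis
    by (simp add: lap_harmonic_ext_split schur_complement_def Let_def left_diff_distrib sum_subtractf)
qed

text \<open>Summation by parts, where harmonicity leaves only the vertices of \<open>X\<close>. The
  Schur complement is thus the energy form on harmonic extensions.\<close>

lemma schur_form:
  "(\<Sum>v\<in>X. p v * (\<Sum>x\<in>X. schur_complement G X v x * u x)) = dform (harmonic_ext X p) (harmonic_ext X u)"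
proof -
  have "dform (harmonic_ext X p) (harmonic_ext X u) = (\<Sum>v\<in>X. p v * lap (harmonic_ext X u) v)"
    unfolding dform_eq_sum_lap using X lap_harmonic_ext_outside
    by (intro sum.mono_neutral_cong_right) (auto simp: harmonic_ext_def)
  then show ?thesis by (simp add: lap_harmonic_ext_inside)
qed

text \<open>The difference from the harmonic extension vanishes on \<open>X\<close>, and the
  Laplacian of the extension vanishes off \<open>X\<close>. The two are therefore orthogonal and
  energies add up.\<close>

lemma dirichlet_principle:
  assumes "\<And>x. x \<in> X \<Longrightarrow> f x = u x"
  shows "energy (harmonic_ext X u) \<le> energy f"
proof -
  let ?h = "harmonic_ext X u"
  define g where "g = (\<lambda>v. f v - ?h v)"
  have "g v * lap ?h v = 0" if "v \<in> V" for v
  proof (cases "v \<in> X")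
    case True
    then show ?thesis using assms by (simp add: g_def harmonic_ext_def)
  next
    case False
    then show ?thesis using lap_harmonic_ext_outside that by simp
  qed
  then have "dform g ?h = 0"
    unfolding dform_eq_sum_lap by (intro sum.neutral) auto
  moreover have "f = (\<lambda>v. ?h v + 1 * g v)" by (auto simp: g_def)
  ultimately have "energy f = energy ?h + energy g"
    using energy_add_scaled[of ?h 1 g] by (simp add: dform_commute)
  then show ?thesis using energy_nonneg[of g] by simp
qed

text \<open>The harmonic extension of the constant 1 has energy at most 0, so it is constant and its
  Laplacian vanishes.\<close>

lemma schur_row_sum:
  assumes "v \<in> X"
  shows "(\<Sum>x\<in>X. schur_complement G X v x) = 0"
proof -
  let ?h = "harmonic_ext X (\<lambda>_. 1)"
  have "energy ?h \<le> energy (\<lambda>_. 1)" by (rule dirichlet_principle) simp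
  then have "energy ?h = 0" using energy_nonneg[of ?h] by (simp add: dform_def)
  then have "lap ?h v = 0"
    using energy_zero_imp_const assms X by (intro lap_const) auto
  then show ?thesis using lap_harmonic_ext_inside[OF assms, of "\<lambda>_. 1"] by simp
qed

lemma finite_X [simp]: "finite X"
  using X finite_V by (metis finite_subset)

lemma schur_diag:
  assumes "a \<in> X"
  shows "schur_complement G X a a = energy (harmonic_ext X (\<lambda>v. if v = a then 1 else 0))"
  unfolding schur_form[symmetric] using assms
  by (simp add: if_distrib[of "\<lambda>z. z * _"] if_distrib[of "\<lambda>z. _ * z"] cong: if_cong)

lemma wdegree_schur_graph:
  assumes "a \<in> X"
  shows "wdegree (schur_graph G X) a = schur_complement G X a a"
proof -
  have "wdegree (schur_graph G X) a = - (\<Sum>v\<in>X - {a}. schur_complement G X a v)"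
    unfolding wdegree_def schur_graph_def sum_negf[symmetric] using assms
    by (simp, intro sum.mono_neutral_cong_right) auto
  then show ?thesis using schur_row_sum[OF assms] assms by (simp add: sum.remove[of X a])
qed

lemma wdegree_schur_graph_le:
  assumes "a \<in> X"
  shows "wdegree (schur_graph G X) a \<le> c a"
proof -
  have "a \<in> V" using assms X by blast
  then show ?thesis
    unfolding wdegree_schur_graph[OF assms] schur_diag[OF assms]
    using dirichlet_principle[of "\<lambda>v. if v = a then 1 else 0"] by (simp add: energy_delta)
qed

text \<open>The degree is the energy of a harmonic function equal to a point indicator on
  \<open>X\<close>; only the edges inside \<open>X\<close> are kept.\<close>

lemma wdegree_schur_graph_ge:
  assumes "a \<in> X"
  shows "(\<Sum>b\<in>X. w a b) \<le> wdegree (schur_graph G X) a"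
proof -
  define h where "h = harmonic_ext X (\<lambda>v. if v = a then 1 else 0)"
  have aV: "a \<in> V" using assms X by blast
  have h: "h v = (if v = a then 1 else 0)" if "v \<in> X" for v
    using that by (simp add: h_def harmonic_ext_def)
  have "2 * energy h = (\<Sum>u\<in>V. \<Sum>v\<in>V. w u v * (h u - h v)\<^sup>2)"
    by (simp add: energy_eq)
  also have "\<dots> \<ge> (\<Sum>u\<in>X. \<Sum>v\<in>X. w u v * (h u - h v)\<^sup>2)" (is "_ \<ge> ?R")
    using X by (intro order_trans[OF sum_mono sum_mono2] sum_mono2)
       (auto intro!: sum_nonneg mult_nonneg_nonneg w_nonneg)
  \<comment> \<open>The pair \<open>u = v = a\<close> is counted by both summands, which is harmless
    since there are no loops.\<close>
  also have "?R = (\<Sum>u\<in>X. \<Sum>v\<in>X. (if u = a then w a v else 0) + (if v = a then w a u else 0))"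
    using X aV by (intro sum.cong) (auto simp: h w_loop w_sym subset_eq)
  also have "\<dots> = (\<Sum>u\<in>X. (if u = a then \<Sum>b\<in>X. w a b else 0) + w a u)"
    using assms by (intro sum.cong) (auto simp: sum.distrib)
  also have "\<dots> = 2 * (\<Sum>b\<in>X. w a b)"
    using assms by (simp add: sum.distrib)
  finally show ?thesis
    by (simp add: wdegree_schur_graph[OF assms] schur_diag[OF assms] h_def)
qed

end

lemma wdegree_schur_graph_pos:
  assumes "X \<subseteq> V" "a \<in> X" "b \<in> X" "a \<noteq> b"
  shows "0 < wdegree (schur_graph G X) a"
proof -
  have "0 < energy (harmonic_ext X (\<lambda>v. if v = a then 1 else 0))"
    using assms by (intro energy_pos[of a b]) (auto simp: harmonic_ext_def)
  moreover have "X \<noteq> {}" using assms by blast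
  ultimately show ?thesis
    using assms by (simp add: wdegree_schur_graph schur_diag)
qed

section \<open>Cuts and volumes of a pair of sets in the Schur complement graph\<close>

context
  fixes A B
  assumes AB: "A \<subseteq> V" "B \<subseteq> V" "A \<inter> B = {}" "A \<noteq> {}" "B \<noteq> {}"
begin

lemma finite_AB [simp]: "finite A" "finite B"
  using AB finite_V by (metis finite_subset)+

lemma AB_subset: "A \<union> B \<subseteq> V" "A \<union> B \<noteq> {}"
  using AB by auto

text \<open>The energy is the sum of the Schur complement over \<open>A \<times> A\<close>; zero row
  sums turn it into minus the sum over \<open>A \<times> B\<close>.\<close>

lemma cut_weight_schur_graph:
  "cut_weight (schur_graph G (A \<union> B)) A B
     = energy (harmonic_ext (A \<union> B) (\<lambda>v. if v \<in> A then 1 else 0))"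
proof -
  let ?X = "A \<union> B" let ?S = "schur_complement G ?X"
  let ?i = "\<lambda>v. if v \<in> A then 1 else 0 :: real"
  have row: "(\<Sum>b\<in>A. ?S a b) = - (\<Sum>b\<in>B. ?S a b)" if "a \<in> A" for a
    using schur_row_sum[OF AB_subset, of a] that AB(3) by (simp add: sum.union_disjoint)
  have ind: "(\<Sum>x\<in>?X. ?S v x * ?i x) = (\<Sum>x\<in>A. ?S v x)" for v
    by (intro sum.mono_neutral_cong_right) auto
  have "energy (harmonic_ext ?X ?i) = (\<Sum>v\<in>?X. ?i v * (\<Sum>x\<in>A. ?S v x))"
    using schur_form[OF AB_subset, of ?i ?i] by (simp add: ind)
  also have "\<dots> = (\<Sum>v\<in>A. \<Sum>x\<in>A. ?S v x)"
    by (intro sum.mono_neutral_cong_right) auto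
  also have "\<dots> = (\<Sum>a\<in>A. \<Sum>b\<in>B. - ?S a b)"
    by (simp add: row sum_negf)
  also have "\<dots> = cut_weight (schur_graph G ?X) A B"
    unfolding cut_weight_def schur_graph_def using AB(3) by (intro sum.cong) auto
  finally show ?thesis by simp
qed

lemma vol_schur_graph_pos:
  "0 < vol (schur_graph G (A \<union> B)) A" "0 < vol (schur_graph G (A \<union> B)) B"
proof -
  obtain a b where ab: "a \<in> A" "b \<in> B" using AB by auto
  have "0 < wdegree (schur_graph G (A \<union> B)) x" if "x \<in> A" for x
    using AB ab that by (intro wdegree_schur_graph_pos[of _ x b]) auto
  then show "0 < vol (schur_graph G (A \<union> B)) A"
    unfolding vol_def using AB by (intro sum_pos) auto
  have "0 < wdegree (schur_graph G (A \<union> B)) x" if "x \<in> B" for x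
    using AB ab that by (intro wdegree_schur_graph_pos[of _ x a]) auto
  then show "0 < vol (schur_graph G (A \<union> B)) B"
    unfolding vol_def using AB by (intro sum_pos) auto
qed

lemma vol_schur_graph_ge:
  assumes "C \<subseteq> A \<union> B"
  shows "vol G C - (\<Sum>a\<in>C. \<Sum>b\<in>V - (A \<union> B). w a b) \<le> vol (schur_graph G (A \<union> B)) C"
proof -
  have "c a - (\<Sum>b\<in>V - (A \<union> B). w a b) \<le> wdegree (schur_graph G (A \<union> B)) a" if "a \<in> C" for a
  proof -
    have "c a = (\<Sum>b\<in>V - (A \<union> B). w a b) + (\<Sum>b\<in>A \<union> B. w a b)"
      unfolding wdegree_def using AB by (intro sum.subset_diff) auto
    then show ?thesis
      using wdegree_schur_graph_ge[OF AB_subset, of a] that assms by auto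
  qed
  then show ?thesis
    unfolding vol_def sum_subtractf[symmetric] by (intro sum_mono)
qed

text \<open>The harmonic function \<open>f\<close> is 1 on \<open>A\<close> and 0 on
  \<open>B\<close>, so its deviation from any \<open>m\<close> is at least half the smaller volume.
  Degrees in the Schur complement graph are at most those in \<open>G\<close>, which brings in the
  Poincare inequality.\<close>

lemma rho_pair_ge:
  assumes poincare: "\<And>f. \<exists>m. l * (\<Sum>v\<in>V. c v * (f v - m)\<^sup>2) \<le> energy f" and "0 \<le> l"
  shows "l / 2 \<le> rho_pair G A B"
proof -
  let ?X = "A \<union> B" let ?I = "schur_graph G ?X"
  define f where "f = harmonic_ext ?X (\<lambda>v. if v \<in> A then 1 else 0)"
  obtain m where m: "l * (\<Sum>v\<in>V. c v * (f v - m)\<^sup>2) \<le> energy f"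
    using poincare by blast
  let ?M = "min (vol ?I A) (vol ?I B)"
  have M: "0 < ?M" using vol_schur_graph_pos by simp
  \<comment> \<open>The worst constant is \<open>m = 1 / 2\<close>; this is the source of the factor
    \<open>1 / 2\<close> in the lower bound.\<close>
  have "1 / 2 \<le> (1 - m)\<^sup>2 + m\<^sup>2"
  proof -
    have "(1 - m)\<^sup>2 + m\<^sup>2 - 1 / 2 = 2 * (m - 1 / 2)\<^sup>2"
      by (simp add: power2_eq_square algebra_simps)
    then show ?thesis by (smt (verit) zero_le_power2)
  qed
  then have "?M / 2 \<le> ?M * ((1 - m)\<^sup>2 + m\<^sup>2)"
    using mult_left_mono[of "1 / 2" _ ?M] M by simp
  also have "\<dots> \<le> vol ?I A * (1 - m)\<^sup>2 + vol ?I B * m\<^sup>2"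
    unfolding distrib_left by (intro add_mono mult_right_mono) auto
  also have "\<dots> = (\<Sum>v\<in>A. wdegree ?I v * (f v - m)\<^sup>2) + (\<Sum>v\<in>B. wdegree ?I v * (f v - m)\<^sup>2)"
    unfolding vol_def sum_distrib_right using AB(3)
    by (intro arg_cong2[where f = "(+)"] sum.cong) (auto simp: f_def harmonic_ext_def)
  also have "\<dots> = (\<Sum>v\<in>?X. wdegree ?I v * (f v - m)\<^sup>2)"
    using AB(3) by (simp add: sum.union_disjoint)
  also have "\<dots> \<le> (\<Sum>v\<in>?X. c v * (f v - m)\<^sup>2)"
    using wdegree_schur_graph_le[OF AB_subset] by (intro sum_mono mult_right_mono) auto
  also have "\<dots> \<le> (\<Sum>v\<in>V. c v * (f v - m)\<^sup>2)"
    using AB by (intro sum_mono2) (auto simp: less_imp_le[OF c_pos])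
  finally have "l * (?M / 2) \<le> energy f"
    using m \<open>0 \<le> l\<close> by (meson mult_left_mono order_trans)
  then show ?thesis
    using M by (simp add: rho_pair_def Let_def cut_weight_schur_graph f_def field_simps)
qed

text \<open>Multiplied out because the lower estimate for the volumes may be negative.\<close>

lemma rho_pair_mult_le:
  assumes "\<And>v. v \<in> A \<Longrightarrow> f v = 1" "\<And>v. v \<in> B \<Longrightarrow> f v = 0"
    and "0 \<le> r" "r \<le> rho_pair G A B" "vol G A \<le> vol G B"
  shows "r * (vol G A - (\<Sum>a\<in>A. \<Sum>b\<in>V - (A \<union> B). w a b) - (\<Sum>a\<in>B. \<Sum>b\<in>V - (A \<union> B). w a b))
      \<le> energy f"
proof -
  let ?X = "A \<union> B" let ?I = "schur_graph G ?X"
  let ?M = "min (vol ?I A) (vol ?I B)"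
  let ?p = "\<lambda>C. \<Sum>a\<in>C. \<Sum>b\<in>V - ?X. w a b"
  have "0 \<le> ?p A" "0 \<le> ?p B"
    using AB by (auto intro!: sum_nonneg w_nonneg)
  then have "vol G A - ?p A - ?p B \<le> ?M"
    using vol_schur_graph_ge[of A] vol_schur_graph_ge[of B] assms by simp
  then have "r * (vol G A - ?p A - ?p B) \<le> r * ?M"
    using assms by (intro mult_left_mono)
  also have "\<dots> \<le> rho_pair G A B * ?M"
    using assms vol_schur_graph_pos by (intro mult_right_mono) auto
  also have "\<dots> = cut_weight ?I A B"
    using vol_schur_graph_pos by (simp add: rho_pair_def Let_def)
  also have "\<dots> \<le> energy f"
    unfolding cut_weight_schur_graph using assms AB(3)
    by (intro dirichlet_principle[OF AB_subset]) auto
  finally show ?thesis .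
qed

end

text \<open>With two vertices there is only one possible edge, so by symmetry of the Schur
  complement the cut and both volumes coincide.\<close>

lemma rho_pair_singletons:
  assumes "a \<in> V" "b \<in> V" "a \<noteq> b"
  shows "rho_pair G {a} {b} = 1"
proof -
  let ?X = "{a} \<union> {b}" let ?S = "schur_complement G ?X" let ?I = "schur_graph G ?X"
  have X: "?X \<subseteq> V" "?X \<noteq> {}" using assms by auto
  have pos: "0 < vol ?I {a}" "0 < vol ?I {b}"
    using assms vol_schur_graph_pos[of "{a}" "{b}"] by auto
  have "cut_weight ?I {a} {b} = vol ?I {a}"
    using assms by (simp add: cut_weight_def vol_def wdegree_def schur_graph_def)
  moreover have "vol ?I {a} = vol ?I {b}"
  proof -
    have "?S a b = ?S b a"
      using schur_form[OF X, of "\<lambda>v. if v = a then 1 else 0" "\<lambda>v. if v = b then 1 else 0"]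
        schur_form[OF X, of "\<lambda>v. if v = b then 1 else 0" "\<lambda>v. if v = a then 1 else 0"]
        assms by (simp add: dform_commute)
    then show ?thesis using assms by (simp add: vol_def wdegree_def schur_graph_def)
  qed
  ultimately show ?thesis using pos by (simp add: rho_pair_def Let_def)
qed

section \<open>The minimum over all pairs of sets\<close>

abbreviation "rho_set \<equiv> {rho_pair G A B | A B.
       A \<subseteq> V \<and> B \<subseteq> V \<and> A \<inter> B = {} \<and> A \<noteq> {} \<and> B \<noteq> {}}"

lemma finite_rho_set: "finite rho_set"
proof (rule finite_subset)
  show "rho_set \<subseteq> (\<lambda>(A, B). rho_pair G A B) ` (Pow V \<times> Pow V)" by auto
  show "finite ((\<lambda>(A, B). rho_pair G A B) ` (Pow V \<times> Pow V))" by simp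
qed

lemma rho_graph_le:
  assumes "A \<subseteq> V" "B \<subseteq> V" "A \<inter> B = {}" "A \<noteq> {}" "B \<noteq> {}"
  shows "rho_graph G \<le> rho_pair G A B"
  unfolding rho_graph_def by (rule Min_le[OF finite_rho_set]) (use assms in blast)

lemma rho_graph_le_1: "rho_graph G \<le> 1"
proof -
  have "V \<noteq> {}" using card_verts by auto
  then obtain a b where "a \<in> V" "b \<in> V" "a \<noteq> b" using exists_other by blast
  then show ?thesis using rho_graph_le[of "{a}" "{b}"] rho_pair_singletons[of a b] by auto
qed

lemma rho_graph_ge:
  assumes "\<And>f. \<exists>m. l * (\<Sum>v\<in>V. c v * (f v - m)\<^sup>2) \<le> energy f" and "0 \<le> l"
  shows "l / 2 \<le> rho_graph G"
proof -
  have "V \<noteq> {}" using card_verts by auto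
  then obtain a b where "a \<in> V" "b \<in> V" "a \<noteq> b" using exists_other by blast
  then have "rho_pair G {a} {b} \<in> rho_set" by blast
  then have "rho_set \<noteq> {}" by blast
  then show ?thesis
    unfolding rho_graph_def using rho_pair_ge[OF _ _ _ _ _ assms]
    by (subst Min_ge_iff[OF finite_rho_set]) auto
qed

subsection \<open>Eigenvalues of the normalized Laplacian\<close>

text \<open>The generalised eigenvalue problem \<open>L f = \<mu> D f\<close>, to which the
  substitution \<open>x = D^(1/2) f\<close> reduces the normalized Laplacian.\<close>

definition eigenfunction :: "real \<Rightarrow> ('a \<Rightarrow> real) \<Rightarrow> bool" where
  "eigenfunction \<mu> f \<longleftrightarrow> (\<exists>v\<in>V. f v \<noteq> 0) \<and> (\<forall>v\<in>V. lap f v = \<mu> * c v * f v)"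

lemma normalized_laplacian_apply:
  assumes "i \<in> V" "\<And>v. v \<in> V \<Longrightarrow> x v = sqrt (c v) * f v"
  shows "(\<Sum>j\<in>V. normalized_laplacian G i j * x j) = \<mu> * x i \<longleftrightarrow> lap f i = \<mu> * c i * f i"
proof -
  have ent: "normalized_laplacian G i j = laplacian G i j / (sqrt (c i) * sqrt (c j))" if "j \<in> V" for j
  proof -
    have "mmult V (mdiag (\<lambda>v. 1 / sqrt (c v))) (laplacian G) i k = laplacian G i k / sqrt (c i)" for k
      using assms(1) unfolding mmult_def mdiag_def
      by (simp add: if_distrib[of "\<lambda>z. z * _"] cong: if_cong)
    then show ?thesis
      using that unfolding normalized_laplacian_def Let_def
      by (subst mmult_def) (simp add: mdiag_def if_distrib[of "\<lambda>z. _ * z"] cong: if_cong)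
  qed
  have "(\<Sum>j\<in>V. normalized_laplacian G i j * x j) = (\<Sum>j\<in>V. laplacian G i j * f j / sqrt (c i))"
    using assms(2) c_pos by (intro sum.cong refl) (auto simp: ent less_imp_neq[THEN not_sym] dest: c_pos)
  also have "\<dots> = lap f i / sqrt (c i)"
    using assms(1) by (simp add: laplacian_apply[symmetric] sum_divide_distrib)
  finally have sum: "(\<Sum>j\<in>V. normalized_laplacian G i j * x j) = lap f i / sqrt (c i)" .
  have "lap f i / s = \<mu> * (s * f i) \<longleftrightarrow> lap f i = \<mu> * (s * s) * f i" if "s \<noteq> 0" for s
    using that by (simp add: nonzero_divide_eq_eq mult_ac)
  from this[of "sqrt (c i)"] show ?thesis
    unfolding sum assms(2)[OF assms(1)] using c_pos[OF assms(1)] by simp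
qed

lemma is_eigenvalue_iff:
  "is_eigenvalue V (normalized_laplacian G) \<mu> \<longleftrightarrow> (\<exists>f. eigenfunction \<mu> f)"
proof
  assume "is_eigenvalue V (normalized_laplacian G) \<mu>"
  then obtain x where x: "\<exists>i\<in>V. x i \<noteq> 0"
      "\<forall>i\<in>V. (\<Sum>j\<in>V. normalized_laplacian G i j * x j) = \<mu> * x i"
    unfolding is_eigenvalue_def by blast
  have *: "x v = sqrt (c v) * (x v / sqrt (c v))" if "v \<in> V" for v
    using c_pos[OF that] by simp
  have "eigenfunction \<mu> (\<lambda>v. x v / sqrt (c v))"
    unfolding eigenfunction_def
  proof (intro conjI ballI)
    show "\<exists>v\<in>V. x v / sqrt (c v) \<noteq> 0" using x(1) c_pos by force
  next
    fix v assume "v \<in> V"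
    then show "lap (\<lambda>v. x v / sqrt (c v)) v = \<mu> * c v * (x v / sqrt (c v))"
      using normalized_laplacian_apply[of v x "\<lambda>v. x v / sqrt (c v)" \<mu>, OF _ *] x(2) by blast
  qed
  then show "\<exists>f. eigenfunction \<mu> f" by blast
next
  assume "\<exists>f. eigenfunction \<mu> f"
  then obtain f where f: "eigenfunction \<mu> f" by blast
  show "is_eigenvalue V (normalized_laplacian G) \<mu>"
    unfolding is_eigenvalue_def
  proof (intro exI conjI ballI)
    show "\<exists>i\<in>V. sqrt (c i) * f i \<noteq> 0" using f c_pos unfolding eigenfunction_def by force
  next
    fix i assume "i \<in> V"
    then show "(\<Sum>j\<in>V. normalized_laplacian G i j * (sqrt (c j) * f j)) = \<mu> * (sqrt (c i) * f i)"
      using normalized_laplacian_apply[of i "\<lambda>v. sqrt (c v) * f v" f \<mu>] f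
      unfolding eigenfunction_def by blast
  qed
qed

lemma eigenfunction_dform:
  assumes "eigenfunction \<mu> f"
  shows "dform g f = \<mu> * (\<Sum>v\<in>V. c v * (g v * f v))"
  unfolding dform_eq_sum_lap sum_distrib_left
  using assms by (intro sum.cong) (auto simp: eigenfunction_def)

lemma eigenfunction_orthogonal:
  assumes "eigenfunction \<mu> f" "eigenfunction \<nu> g" "\<mu> \<noteq> \<nu>"
  shows "(\<Sum>v\<in>V. c v * (g v * f v)) = 0"
proof -
  have "(\<Sum>v\<in>V. c v * (f v * g v)) = (\<Sum>v\<in>V. c v * (g v * f v))"
    by (simp add: mult.commute)
  then have "\<mu> * (\<Sum>v\<in>V. c v * (g v * f v)) = \<nu> * (\<Sum>v\<in>V. c v * (g v * f v))"
    using eigenfunction_dform[OF assms(1), of g] eigenfunction_dform[OF assms(2), of f]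
    by (metis dform_commute)
  then show ?thesis using assms(3) by simp
qed

lemma weighted_norm_pos:
  assumes "\<exists>v\<in>V. f v \<noteq> 0"
  shows "0 < (\<Sum>v\<in>V. c v * (f v * f v))"
proof -
  obtain v where v: "v \<in> V" "f v \<noteq> 0" using assms by blast
  then show ?thesis
    using c_pos by (intro sum_pos2[of V v]) (auto simp: less_imp_le zero_less_mult_iff zero_le_mult_iff linorder_neq_iff dest: c_pos)
qed

text \<open>Bessel's inequality for the eigenfunctions, evaluated at each vertex and summed over
  all vertices, bounds the number of distinct eigenvalues.\<close>

lemma finite_eigenvalues: "finite {\<mu>. \<exists>f. eigenfunction \<mu> f}"
proof -
  have "card K \<le> card V" if K: "K \<subseteq> {\<mu>. \<exists>f. eigenfunction \<mu> f}" "finite K" for K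
  proof -
    define F where "F \<mu> = (SOME f. eigenfunction \<mu> f)" for \<mu>
    have F: "eigenfunction \<mu> (F \<mu>)" if "\<mu> \<in> K" for \<mu>
      using that K unfolding F_def by (metis (mono_tags) mem_Collect_eq someI_ex subsetD)
    define n where "n \<mu> = (\<Sum>v\<in>V. c v * (F \<mu> v * F \<mu> v))" for \<mu>
    have n: "0 < n \<mu>" if "\<mu> \<in> K" for \<mu>
      using F[OF that] weighted_norm_pos unfolding n_def eigenfunction_def by blast
    have bessel: "(\<Sum>\<mu>\<in>K. c i * (F \<mu> i * F \<mu> i) / n \<mu>) \<le> 1" if i: "i \<in> V" for i
    proof -
      \<comment> \<open>\<open>p\<close> is the projection of the point indicator at
        \<open>i\<close>, divided by \<open>c i\<close>, to the span of the chosen eigenfunctions in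
        the inner product weighted by \<open>c\<close>. Pairing with that vector evaluates at
        \<open>i\<close>, so the squared norm of \<open>p\<close> is \<open>p i\<close>.\<close>
      define p where "p v = (\<Sum>\<mu>\<in>K. F \<mu> i / n \<mu> * F \<mu> v)" for v
      have "(\<Sum>v\<in>V. c v * (p v * p v))
          = (\<Sum>v\<in>V. \<Sum>\<mu>\<in>K. \<Sum>\<nu>\<in>K. F \<mu> i / n \<mu> * (F \<nu> i / n \<nu>) * (c v * (F \<mu> v * F \<nu> v)))"
        unfolding p_def sum_product unfolding sum_distrib_left by (simp add: mult_ac)
      also have "\<dots> = (\<Sum>\<mu>\<in>K. \<Sum>\<nu>\<in>K. F \<mu> i / n \<mu> * (F \<nu> i / n \<nu>) * (\<Sum>v\<in>V. c v * (F \<mu> v * F \<nu> v)))"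
        unfolding sum_distrib_left by (subst sum.swap, intro sum.cong refl, subst sum.swap) simp
      also have "\<dots> = (\<Sum>\<mu>\<in>K. \<Sum>\<nu>\<in>K. if \<nu> = \<mu> then F \<mu> i / n \<mu> * F \<mu> i else 0)"
      proof (intro sum.cong refl)
        fix \<mu> \<nu> assume "\<mu> \<in> K" "\<nu> \<in> K"
        then show "F \<mu> i / n \<mu> * (F \<nu> i / n \<nu>) * (\<Sum>v\<in>V. c v * (F \<mu> v * F \<nu> v))
            = (if \<nu> = \<mu> then F \<mu> i / n \<mu> * F \<mu> i else 0)"
          using eigenfunction_orthogonal[OF F F, of \<nu> \<mu>] n[of \<mu>] by (auto simp: n_def[symmetric])
      qed
      also have "\<dots> = p i" using \<open>finite K\<close> by (simp add: p_def)
      finally have eq: "(\<Sum>v\<in>V. c v * (p v * p v)) = p i" .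
      have "c i * (p i * p i) \<le> (\<Sum>v\<in>V. c v * (p v * p v))"
        using i by (intro member_le_sum) (auto simp: less_imp_le[OF c_pos])
      then have "p i * (c i * p i) \<le> p i * 1" using eq by (simp add: mult_ac)
      moreover have "0 \<le> p i"
        unfolding eq[symmetric] by (intro sum_nonneg) (auto simp: less_imp_le[OF c_pos])
      ultimately have "c i * p i \<le> 1"
        by (cases "p i = 0") auto
      then show ?thesis
        by (simp add: p_def sum_distrib_left mult_ac)
    qed
    have "real (card K) = (\<Sum>\<mu>\<in>K. \<Sum>i\<in>V. c i * (F \<mu> i * F \<mu> i) / n \<mu>)"
      using n by (simp add: sum_divide_distrib[symmetric] n_def[symmetric] less_imp_neq[THEN not_sym])
    also have "\<dots> = (\<Sum>i\<in>V. \<Sum>\<mu>\<in>K. c i * (F \<mu> i * F \<mu> i) / n \<mu>)" by (rule sum.swap)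
    also have "\<dots> \<le> (\<Sum>i\<in>V. 1)" by (intro sum_mono bessel)
    finally show ?thesis by simp
  qed
  then show ?thesis using finite_if_finite_subsets_card_bdd by blast
qed

section \<open>Rayleigh quotient and Poincare inequality\<close>

lemma energy_affine: "energy (\<lambda>v. s * (f v - m)) = s\<^sup>2 * energy f"
proof -
  have "(\<Sum>u\<in>V. \<Sum>v\<in>V. w u v * (s * (f u - m) - s * (f v - m))\<^sup>2)
      = s\<^sup>2 * (\<Sum>u\<in>V. \<Sum>v\<in>V. w u v * (f u - f v)\<^sup>2)"
    unfolding sum_distrib_left
    by (intro sum.cong refl) (simp add: power2_eq_square algebra_simps)
  then show ?thesis by (simp add: energy_eq)
qed

lemma energy_cong: "(\<And>v. v \<in> V \<Longrightarrow> f v = g v) \<Longrightarrow> energy f = energy g"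
  unfolding energy_eq by (simp cong: sum.cong)

lemma sum_c_pos: "0 < sum c V"
proof -
  have "V \<noteq> {}" using card_verts by auto
  then show ?thesis using c_pos by (intro sum_pos) auto
qed

definition mean :: "('a \<Rightarrow> real) \<Rightarrow> real" where
  "mean f = (\<Sum>v\<in>V. c v * f v) / sum c V"

lemma sum_c_mean_zero: "(\<Sum>v\<in>V. c v * (f v - mean f)) = 0"
proof -
  have "(\<Sum>v\<in>V. c v * (f v - mean f)) = (\<Sum>v\<in>V. c v * f v) - sum c V * mean f"
    by (simp add: right_diff_distrib sum_subtractf sum_distrib_right)
  then show ?thesis using sum_c_pos by (simp add: mean_def)
qed

lemma variance_eq:
  "(\<Sum>v\<in>V. c v * (f v - mean f)\<^sup>2) = (\<Sum>v\<in>V. c v * (f v)\<^sup>2) - (\<Sum>v\<in>V. c v * f v)\<^sup>2 / sum c V"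
proof -
  have "(\<Sum>v\<in>V. c v * (f v - mean f)\<^sup>2)
      = (\<Sum>v\<in>V. c v * (f v)\<^sup>2 - 2 * mean f * (c v * f v) + (mean f)\<^sup>2 * c v)"
    by (intro sum.cong refl) (simp add: power2_eq_square algebra_simps)
  also have "\<dots> = (\<Sum>v\<in>V. c v * (f v)\<^sup>2) - 2 * mean f * (\<Sum>v\<in>V. c v * f v) + (mean f)\<^sup>2 * sum c V"
    by (simp add: sum.distrib sum_subtractf sum_distrib_left)
  also have "\<dots> = (\<Sum>v\<in>V. c v * (f v)\<^sup>2) - (\<Sum>v\<in>V. c v * f v)\<^sup>2 / sum c V"
    using sum_c_pos by (simp add: mean_def power2_eq_square field_simps)
  finally show ?thesis .
qed

text \<open>Compactness in the product topology on all functions: the constraints are closed, and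
  the norm constraint bounds every coordinate.\<close>

lemma exists_energy_minimiser:
  obtains h where "(\<Sum>v\<in>V. c v * h v) = 0" "(\<Sum>v\<in>V. c v * (h v)\<^sup>2) = 1"
    "\<And>f. (\<Sum>v\<in>V. c v * f v) = 0 \<Longrightarrow> (\<Sum>v\<in>V. c v * (f v)\<^sup>2) = 1 \<Longrightarrow> energy h \<le> energy f"
proof -
  \<comment> \<open>The factor \<open>{0}\<close> off \<open>V\<close> keeps the product over the
    whole type compact. On \<open>V\<close> the norm constraint gives \<open>f v\<close> squared at
    most \<open>1 / c v\<close>, hence at most the square of \<open>1 + 1 / c v\<close>.\<close>
  define box where "box v = (if v \<in> V then {- (1 + 1 / c v)..1 + 1 / c v} else {0})" for v
  define K where "K = PiE UNIV box \<inter> ({h. (\<Sum>v\<in>V. c v * h v) = 0} \<inter> {h. (\<Sum>v\<in>V. c v * (h v)\<^sup>2) = 1})"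
  have cont: "continuous_on UNIV (\<lambda>h::'a \<Rightarrow> real. h v)" for v
    by (rule continuous_on_product_coordinates)
  have "compact (PiE UNIV box)"
  proof -
    have "compactin (product_topology (\<lambda>_. euclidean) UNIV) (PiE UNIV box)"
      unfolding compactin_PiE by (auto simp: box_def)
    then show ?thesis by (simp add: euclidean_product_topology)
  qed
  moreover have "closed {h::'a \<Rightarrow> real. (\<Sum>v\<in>V. c v * h v) = 0}"
    by (intro closed_Collect_eq continuous_intros cont)
  moreover have "closed {h::'a \<Rightarrow> real. (\<Sum>v\<in>V. c v * (h v)\<^sup>2) = 1}"
    by (intro closed_Collect_eq continuous_intros cont)
  ultimately have "compact K"
    unfolding K_def by (intro compact_Int_closed closed_Int)
  moreover have restrict: "(\<lambda>v. if v \<in> V then f v else 0) \<in> K"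
    if f: "(\<Sum>v\<in>V. c v * f v) = 0" "(\<Sum>v\<in>V. c v * (f v)\<^sup>2) = 1" for f
  proof -
    have "\<bar>f v\<bar> \<le> 1 + 1 / c v" if "v \<in> V" for v
    proof -
      have "c v * (f v)\<^sup>2 \<le> (\<Sum>v\<in>V. c v * (f v)\<^sup>2)"
        using that by (intro member_le_sum) (auto simp: less_imp_le[OF c_pos])
      then have "(f v)\<^sup>2 \<le> 1 / c v"
        using f c_pos[OF that] by (simp add: field_simps)
      also have "\<dots> \<le> (1 + 1 / c v)\<^sup>2"
        using c_pos[OF that] by (simp add: power2_eq_square field_simps)
      finally show ?thesis
        using c_pos[OF that] by (intro abs_le_square_iff[THEN iffD2, of "f v" "1 + 1 / c v", THEN order_trans]) auto
    qed
    then show ?thesis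
      using f by (fastforce simp: K_def box_def PiE_def abs_le_iff cong: sum.cong)
  qed
  moreover have "K \<noteq> {}"
  proof -
    have "V \<noteq> {}" using card_verts by auto
    then obtain a b where ab: "a \<in> V" "b \<in> V" "a \<noteq> b" using exists_other by blast
    \<comment> \<open>This indicator separates \<open>a\<close> from \<open>b\<close>, so its
      centred version is nonzero and can be normalised to a point of \<open>K\<close>.\<close>
    define d where "d v = (if v = a then 1 else 0 :: real)" for v
    define N where "N = (\<Sum>v\<in>V. c v * (d v - mean d)\<^sup>2)"
    have "0 \<le> N" unfolding N_def by (intro sum_nonneg) (auto simp: less_imp_le[OF c_pos])
    moreover have "N \<noteq> 0"
    proof
      assume "N = 0"
      then have "\<forall>v\<in>V. c v * (d v - mean d)\<^sup>2 = 0"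
        unfolding N_def by (subst (asm) sum_nonneg_eq_0_iff) (auto simp: less_imp_le[OF c_pos])
      then have "d a = mean d" "d b = mean d" using ab c_pos by force+
      then show False using ab by (simp add: d_def)
    qed
    ultimately have N: "0 < N" by simp
    define f where "f v = (1 / sqrt N) * (d v - mean d)" for v
    have "(\<Sum>v\<in>V. c v * f v) = (1 / sqrt N) * (\<Sum>v\<in>V. c v * (d v - mean d))"
      unfolding f_def sum_distrib_left by (intro sum.cong) auto
    then have "(\<Sum>v\<in>V. c v * f v) = 0" by (simp add: sum_c_mean_zero)
    moreover have "(\<Sum>v\<in>V. c v * (f v)\<^sup>2) = (1 / N) * (\<Sum>v\<in>V. c v * (d v - mean d)\<^sup>2)"
      unfolding f_def sum_distrib_left using N by (simp add: power_mult_distrib power_divide)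
    then have "(\<Sum>v\<in>V. c v * (f v)\<^sup>2) = 1" using N by (simp add: N_def[symmetric])
    ultimately show ?thesis using restrict[of f] by auto
  qed
  moreover have "continuous_on K energy"
    unfolding energy_eq by (intro continuous_intros continuous_on_subset[OF cont]) auto
  ultimately obtain h where h: "h \<in> K" "\<And>f. f \<in> K \<Longrightarrow> energy h \<le> energy f"
    using continuous_attains_inf[of K energy] by blast
  show ?thesis
  proof
    show "(\<Sum>v\<in>V. c v * h v) = 0" "(\<Sum>v\<in>V. c v * (h v)\<^sup>2) = 1" using h(1) by (auto simp: K_def)
    fix f assume "(\<Sum>v\<in>V. c v * f v) = 0" "(\<Sum>v\<in>V. c v * (f v)\<^sup>2) = 1"
    then have "energy h \<le> energy (\<lambda>v. if v \<in> V then f v else 0)"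
      using h(2) restrict by blast
    also have "\<dots> = energy f" by (rule energy_cong) simp
    finally show "energy h \<le> energy f" .
  qed
qed

text \<open>Let \<open>\<mu>\<close> be the minimal energy under the constraints. Centring and
  scaling give the Poincare inequality, and the first variation at the minimiser gives the
  eigenvalue equation.\<close>

lemma exists_poincare_eigenfunction:
  obtains h \<mu> where "eigenfunction \<mu> h" "0 < \<mu>"
    "\<And>f. \<mu> * (\<Sum>v\<in>V. c v * (f v - mean f)\<^sup>2) \<le> energy f"
proof -
  obtain h where h: "(\<Sum>v\<in>V. c v * h v) = 0" "(\<Sum>v\<in>V. c v * (h v)\<^sup>2) = 1"
    and min: "\<And>f. (\<Sum>v\<in>V. c v * f v) = 0 \<Longrightarrow> (\<Sum>v\<in>V. c v * (f v)\<^sup>2) = 1 \<Longrightarrow> energy h \<le> energy f"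
    by (rule exists_energy_minimiser) blast
  define \<mu> where "\<mu> = energy h"
  have poincare: "\<mu> * (\<Sum>v\<in>V. c v * (f v - mean f)\<^sup>2) \<le> energy f" for f
  proof -
    define N where "N = (\<Sum>v\<in>V. c v * (f v - mean f)\<^sup>2)"
    have "0 \<le> N" unfolding N_def by (intro sum_nonneg) (auto simp: less_imp_le[OF c_pos])
    show ?thesis
    proof (cases "N = 0")
      case True
      then show ?thesis using energy_nonneg[of f] by (simp add: N_def)
    next
      case False
      then have N: "0 < N" using \<open>0 \<le> N\<close> by simp
      define g where "g v = (1 / sqrt N) * (f v - mean f)" for v
      have "(\<Sum>v\<in>V. c v * g v) = (1 / sqrt N) * (\<Sum>v\<in>V. c v * (f v - mean f))"
        unfolding g_def sum_distrib_left by (intro sum.cong) auto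
      then have "(\<Sum>v\<in>V. c v * g v) = 0" by (simp add: sum_c_mean_zero)
      moreover have "(\<Sum>v\<in>V. c v * (g v)\<^sup>2) = (1 / N) * (\<Sum>v\<in>V. c v * (f v - mean f)\<^sup>2)"
        unfolding g_def sum_distrib_left
        using N by (simp add: power_mult_distrib power_divide)
      then have "(\<Sum>v\<in>V. c v * (g v)\<^sup>2) = 1" using N by (simp add: N_def[symmetric])
      ultimately have "\<mu> \<le> energy g" unfolding \<mu>_def by (rule min)
      also have "energy g = energy f / N"
        unfolding g_def energy_affine using N by (simp add: power_divide)
      finally show ?thesis using N by (simp add: N_def[symmetric] field_simps)
    qed
  qed
  have nz: "\<exists>v\<in>V. h v \<noteq> 0"
  proof (rule ccontr)
    assume "\<not> ?thesis"
    then have "(\<Sum>v\<in>V. c v * (h v)\<^sup>2) = 0" by (intro sum.neutral) auto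
    then show False using h by simp
  qed
  have "\<mu> \<noteq> 0"
  proof
    assume "\<mu> = 0"
    obtain v where v: "v \<in> V" "h v \<noteq> 0" using nz by blast
    have "h u = h v" if "u \<in> V" for u
      using energy_zero_imp_const[of h u v] \<open>\<mu> = 0\<close> v that by (simp add: \<mu>_def)
    then have "(\<Sum>u\<in>V. c u * h u) = (\<Sum>u\<in>V. c u * h v)"
      by (intro sum.cong arg_cong2[where f = "(*)"] refl) blast
    then have "sum c V * h v = 0" using h by (simp add: sum_distrib_right)
    then show False using v sum_c_pos by simp
  qed
  then have "0 < \<mu>" using energy_nonneg[of h] by (simp add: \<mu>_def)
  moreover have "lap h v = \<mu> * c v * h v" if v: "v \<in> V" for v
  proof -
    define d where "d u = (if u = v then 1 else 0 :: real)" for u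
    have sums: "(\<Sum>u\<in>V. c u * d u) = c v" "(\<Sum>u\<in>V. c u * (d u)\<^sup>2) = c v"
        "(\<Sum>u\<in>V. c u * (h u * d u)) = c v * h v"
      using v by (auto simp: d_def if_distrib[of "\<lambda>z. _ * z"] if_distrib[of "\<lambda>z. z\<^sup>2"] cong: if_cong)
    have "dform h d = (\<Sum>u\<in>V. d u * lap h u)" 
      by (subst dform_commute) (rule dform_eq_sum_lap)
    then have hd: "dform h d = lap h v"
      using v by (simp add: d_def if_distrib[of "\<lambda>z. z * _"] cong: if_cong)
    have ed: "energy d = c v" using energy_delta[OF v] by (simp add: d_def[abs_def])
    \<comment> \<open>The perturbed function is neither centred nor normalised, so the Poincare
      inequality is used in its variance form. Equality holds at \<open>s = 0\<close>, which forces
      the linear coefficient to vanish.\<close>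
    have "0 \<le> 2 * s * (lap h v - \<mu> * c v * h v) + s\<^sup>2 * (c v - \<mu> * (c v - (c v)\<^sup>2 / sum c V))" for s
    proof -
      let ?f = "\<lambda>u. h u + s * d u"
      have 1: "(\<Sum>u\<in>V. c u * ?f u) = s * c v"
        using h sums by (simp add: distrib_left sum.distrib mult.left_commute[of _ s] sum_distrib_left[symmetric])
      have "(\<Sum>u\<in>V. c u * (?f u)\<^sup>2) = (\<Sum>u\<in>V. c u * (h u)\<^sup>2 + 2 * s * (c u * (h u * d u)) + s\<^sup>2 * (c u * (d u)\<^sup>2))"
        by (intro sum.cong refl) (simp add: power2_eq_square algebra_simps)
      then have 2: "(\<Sum>u\<in>V. c u * (?f u)\<^sup>2) = 1 + 2 * s * (c v * h v) + s\<^sup>2 * c v"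
        using h sums by (simp add: sum.distrib sum_distrib_left[symmetric])
      have "energy ?f = \<mu> + 2 * s * lap h v + s\<^sup>2 * c v"
        unfolding energy_add_scaled hd ed by (simp add: \<mu>_def)
      then have "\<mu> * (1 + 2 * s * (c v * h v) + s\<^sup>2 * c v - (s * c v)\<^sup>2 / sum c V) \<le> \<mu> + 2 * s * lap h v + s\<^sup>2 * c v"
        using poincare[of ?f] unfolding variance_eq 1 2 by simp
      then show ?thesis by (simp add: algebra_simps power_mult_distrib)
    qed
    from linear_coeff_zero[OF this] show ?thesis by simp
  qed
  then have "eigenfunction \<mu> h" using nz by (auto simp: eigenfunction_def)
  ultimately show ?thesis using poincare that by blast
qed

lemma eigenvalue_nonneg:
  assumes "eigenfunction \<mu> f"
  shows "0 \<le> \<mu>"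
proof -
  have "0 < (\<Sum>v\<in>V. c v * (f v * f v))"
    using assms weighted_norm_pos by (auto simp: eigenfunction_def)
  then show ?thesis
    using eigenfunction_dform[OF assms, of f] energy_nonneg[of f] by (simp add: zero_le_mult_iff)
qed

abbreviation "nonzero_eigenvalues \<equiv>
  {\<mu>. is_eigenvalue V (normalized_laplacian G) \<mu> \<and> \<mu> \<noteq> 0}"

lemma finite_nonzero_eigenvalues: "finite nonzero_eigenvalues"
  by (rule finite_subset[OF _ finite_eigenvalues]) (auto simp: is_eigenvalue_iff)

text \<open>The Poincare constant \<open>\<mu>\<close> is itself a nonzero eigenvalue, hence
  \<open>lambda_graph G \<le> \<mu>\<close>, and the inequality passes to the smaller constant.
  Finiteness of the spectrum makes the minimum meaningful.\<close>

lemma lambda_graph_pos: "0 < lambda_graph G"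
  and lambda_graph_eigenfunction: "\<exists>f. eigenfunction (lambda_graph G) f"
  and lambda_graph_poincare:
    "lambda_graph G * (\<Sum>v\<in>V. c v * (f v - mean f)\<^sup>2) \<le> energy f"
proof -
  obtain h \<mu> where \<mu>: "eigenfunction \<mu> h" "0 < \<mu>"
    and poincare: "\<And>f. \<mu> * (\<Sum>v\<in>V. c v * (f v - mean f)\<^sup>2) \<le> energy f"
    by (rule exists_poincare_eigenfunction) blast
  have mem: "\<mu> \<in> nonzero_eigenvalues" using \<mu> is_eigenvalue_iff by auto
  then have "lambda_graph G \<in> nonzero_eigenvalues"
    unfolding lambda_graph_def by (intro Min_in[OF finite_nonzero_eigenvalues]) blast
  then show ex: "\<exists>f. eigenfunction (lambda_graph G) f" and "0 < lambda_graph G"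
    using is_eigenvalue_iff eigenvalue_nonneg by (auto simp: order_less_le)
  have "lambda_graph G \<le> \<mu>"
    unfolding lambda_graph_def by (rule Min_le[OF finite_nonzero_eigenvalues mem])
  then have "lambda_graph G * (\<Sum>v\<in>V. c v * (f v - mean f)\<^sup>2) \<le> \<mu> * (\<Sum>v\<in>V. c v * (f v - mean f)\<^sup>2)"
    by (intro mult_right_mono sum_nonneg) (auto simp: less_imp_le[OF c_pos])
  then show "lambda_graph G * (\<Sum>v\<in>V. c v * (f v - mean f)\<^sup>2) \<le> energy f"
    using poincare[of f] by simp
qed

subsection \<open>Sweep over level sets\<close>

lemma sum_edges_square: "(\<Sum>a\<in>V. \<Sum>b\<in>V. w a b * ((g a)\<^sup>2 + (g b)\<^sup>2)) = 2 * (\<Sum>v\<in>V. c v * (g v)\<^sup>2)"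
proof -
  have "(\<Sum>a\<in>V. \<Sum>b\<in>V. w a b * (g b)\<^sup>2) = (\<Sum>a\<in>V. \<Sum>b\<in>V. w a b * (g a)\<^sup>2)"
    by (subst sum.swap) (auto intro!: sum.cong simp: w_sym)
  then show ?thesis
    by (simp add: distrib_left sum.distrib wdegree_def sum_distrib_right)
qed

text \<open>With \<open>S\<close> the weighted square norm of \<open>g\<close>, integration gives
  \<open>S / 2\<close> for the volumes, at most \<open>S / 4\<close> for the edges lost and at most
  \<open>12 * l * S\<close> for the cuts. Hence the constant 48.\<close>

lemma sweep_bound:
  assumes g: "\<And>v. v \<in> V \<Longrightarrow> 0 \<le> g v"
    and S: "0 < (\<Sum>v\<in>V. c v * (g v)\<^sup>2)"
    and E: "energy g \<le> l * (\<Sum>v\<in>V. c v * (g v)\<^sup>2)"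
    and half: "vol G {v \<in> V. 0 < g v} \<le> vol G {v \<in> V. g v = 0}"
    and zero: "\<exists>v\<in>V. g v = 0"
    and l: "l \<le> 1 / 800"
    and r: "0 \<le> rho_graph G"
  shows "rho_graph G \<le> 48 * l"
proof -
  let ?r = "rho_graph G"
  define S where "S = (\<Sum>v\<in>V. c v * (g v)\<^sup>2)"
  define i where "i x y t = (if t \<in> {x..y} then t else 0)" for x y t :: real
  define J where "J x y = (if x \<le> y then (y\<^sup>2 - x\<^sup>2) / 2 else 0)" for x y :: real
  have iJ: "(i x y has_integral J x y) UNIV" for x y
    unfolding i_def J_def by (rule has_integral_id_indicator)
  \<comment> \<open>Majorant and integral are packed into a pair \<open>q\<close>, so that a single
    choice for each pair of vertices provides both.\<close>
  define P where "P a b q \<longleftrightarrow> (fst q has_integral snd q) UNIV \<and> snd q \<le> 12 * (g a - g b)\<^sup>2 \<and>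
      (\<forall>t. 0 \<le> fst q t) \<and> (\<forall>t>0. t * (ramp t (g a) - ramp t (g b))\<^sup>2 \<le> fst q t)" for a b q
  define Q where "Q a b = (SOME q. P a b q)" for a b
  define U where "U a b = fst (Q a b)" for a b
  define I where "I a b = snd (Q a b)" for a b
  have Q: "P a b (Q a b)" if "a \<in> V" "b \<in> V" for a b
    unfolding Q_def
  proof (rule someI_ex)
    show "\<exists>q. P a b q"
      using ramp_diff_majorant[OF g[OF that(1)] g[OF that(2)]] unfolding P_def by auto
  qed
  have UI: "\<And>a b. a \<in> V \<Longrightarrow> b \<in> V \<Longrightarrow> (U a b has_integral I a b) UNIV"
      "\<And>a b. a \<in> V \<Longrightarrow> b \<in> V \<Longrightarrow> I a b \<le> 12 * (g a - g b)\<^sup>2"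
      "\<And>a b t. a \<in> V \<Longrightarrow> b \<in> V \<Longrightarrow> 0 \<le> U a b t"
      "\<And>a b t. a \<in> V \<Longrightarrow> b \<in> V \<Longrightarrow> 0 < t \<Longrightarrow> t * (ramp t (g a) - ramp t (g b))\<^sup>2 \<le> U a b t"
    using Q unfolding P_def U_def I_def by blast+
  \<comment> \<open>The double sums overestimate \<open>t\<close> times the weight of the edges
    leaving \<open>A \<union> B\<close>: such an edge has \<open>g b < t \<le> g a\<close> if it
    starts in \<open>A\<close>, and \<open>2 * g a \<le> t < 2 * g b\<close> if it starts in
    \<open>B\<close>.\<close>
  define lhs where "lhs t = ?r * ((\<Sum>v\<in>V. c v * i 0 (g v) t) - (\<Sum>a\<in>V. \<Sum>b\<in>V. w a b * i (g b) (g a) t)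
      - (\<Sum>a\<in>V. \<Sum>b\<in>V. w a b * i (2 * g a) (2 * g b) t))" for t
  define rhs where "rhs t = (\<Sum>a\<in>V. \<Sum>b\<in>V. w a b * U a b t) / 2" for t
  have rhs_nonneg: "0 \<le> rhs t" for t
    unfolding rhs_def using UI(3) by (auto intro!: sum_nonneg mult_nonneg_nonneg simp: w_nonneg)
  have i_nonneg: "0 \<le> i x y t" if "0 \<le> x" for x y t
    using that by (auto simp: i_def)
  have pointwise: "lhs t \<le> rhs t" for t
  proof (cases "0 < t \<and> (\<exists>v\<in>V. t \<le> g v)")
    case True
    then have t: "0 < t" by simp
    define A where "A = {v \<in> V. t \<le> g v}"
    define B where "B = {v \<in> V. g v \<le> t / 2}"
    have AB: "A \<subseteq> V" "B \<subseteq> V" "A \<inter> B = {}" "A \<noteq> {}" "B \<noteq> {}"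
      using True zero by (auto simp: A_def B_def)
    have volAB: "vol G A \<le> vol G B"
    proof -
      have "vol G A \<le> vol G {v \<in> V. 0 < g v}"
        unfolding vol_def A_def using t by (intro sum_mono2) (auto simp: less_imp_le[OF c_pos])
      moreover have "vol G {v \<in> V. g v = 0} \<le> vol G B"
        unfolding vol_def B_def using t by (intro sum_mono2) (auto simp: less_imp_le[OF c_pos])
      ultimately show ?thesis using half by simp
    qed
    have ext: "ramp t (g v) = 1" if "v \<in> A" for v
      using that t by (simp add: A_def ramp_eq_1)
    have ext0: "ramp t (g v) = 0" if "v \<in> B" for v
      using that t by (simp add: B_def ramp_eq_0)
    let ?p = "\<lambda>C. \<Sum>a\<in>C. \<Sum>b\<in>V - (A \<union> B). w a b"
    have main: "?r * (vol G A - ?p A - ?p B) \<le> energy (\<lambda>v. ramp t (g v))"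
      using rho_pair_mult_le[OF AB ext ext0 r rho_graph_le[OF AB] volAB] .
    have volA: "(\<Sum>v\<in>V. c v * i 0 (g v) t) = t * vol G A"
      unfolding vol_def sum_distrib_left A_def using t
      by (intro sum.mono_neutral_cong_right) (auto simp: i_def)
    have pA: "t * ?p A \<le> (\<Sum>a\<in>V. \<Sum>b\<in>V. w a b * i (g b) (g a) t)"
    proof -
      have "t * ?p A = (\<Sum>a\<in>A. \<Sum>b\<in>V - (A \<union> B). w a b * i (g b) (g a) t)"
        unfolding sum_distrib_left by (intro sum.cong refl) (auto simp: A_def i_def)
      also have "\<dots> \<le> (\<Sum>a\<in>A. \<Sum>b\<in>V. w a b * i (g b) (g a) t)"
        using AB by (intro sum_mono sum_mono2) (auto intro!: mult_nonneg_nonneg w_nonneg i_nonneg g)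
      also have "\<dots> \<le> (\<Sum>a\<in>V. \<Sum>b\<in>V. w a b * i (g b) (g a) t)"
        using AB by (intro sum_mono2) (auto intro!: sum_nonneg mult_nonneg_nonneg w_nonneg i_nonneg g)
      finally show ?thesis .
    qed
    have pB: "t * ?p B \<le> (\<Sum>a\<in>V. \<Sum>b\<in>V. w a b * i (2 * g a) (2 * g b) t)"
    proof -
      have "t * ?p B = (\<Sum>a\<in>B. \<Sum>b\<in>V - (A \<union> B). w a b * i (2 * g a) (2 * g b) t)"
        unfolding sum_distrib_left by (intro sum.cong refl) (auto simp: B_def i_def)
      also have "\<dots> \<le> (\<Sum>a\<in>B. \<Sum>b\<in>V. w a b * i (2 * g a) (2 * g b) t)"
        using AB by (intro sum_mono sum_mono2) (auto intro!: mult_nonneg_nonneg w_nonneg i_nonneg g)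
      also have "\<dots> \<le> (\<Sum>a\<in>V. \<Sum>b\<in>V. w a b * i (2 * g a) (2 * g b) t)"
        using AB by (intro sum_mono2) (auto intro!: sum_nonneg mult_nonneg_nonneg w_nonneg i_nonneg g)
      finally show ?thesis .
    qed
    have "lhs t \<le> ?r * (t * vol G A - t * ?p A - t * ?p B)"
      unfolding lhs_def volA using pA pB r by (intro mult_left_mono) auto
    also have "\<dots> = t * (?r * (vol G A - ?p A - ?p B))" by (simp add: algebra_simps)
    also have "\<dots> \<le> t * energy (\<lambda>v. ramp t (g v))"
      using main t by simp
    also have "\<dots> = (\<Sum>a\<in>V. \<Sum>b\<in>V. w a b * (t * (ramp t (g a) - ramp t (g b))\<^sup>2)) / 2"
      by (simp add: energy_eq sum_distrib_left mult.left_commute)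
    also have "\<dots> \<le> rhs t"
      unfolding rhs_def using UI(4)[OF _ _ t]
      by (intro divide_right_mono sum_mono mult_left_mono) (auto simp: w_nonneg)
    finally show ?thesis .
  next
    case False
    \<comment> \<open>Here \<open>t \<le> 0\<close> or the upper level set is empty; the volume term
      vanishes and only nonnegative losses are subtracted.\<close>
    have "c v * i 0 (g v) t = 0" if "v \<in> V" for v
      using False that by (auto simp: i_def)
    then have z: "(\<Sum>v\<in>V. c v * i 0 (g v) t) = 0" by (intro sum.neutral) auto
    have "0 \<le> (\<Sum>a\<in>V. \<Sum>b\<in>V. w a b * i (g b) (g a) t)"
      "0 \<le> (\<Sum>a\<in>V. \<Sum>b\<in>V. w a b * i (2 * g a) (2 * g b) t)"
      by (auto intro!: sum_nonneg mult_nonneg_nonneg w_nonneg i_nonneg g)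
    then have "lhs t \<le> 0"
      unfolding lhs_def z using r by (simp add: mult_nonneg_nonpos)
    then show ?thesis using rhs_nonneg[of t] by simp
  qed
  let ?J1 = "\<Sum>a\<in>V. \<Sum>b\<in>V. w a b * J (g b) (g a)"
  let ?J2 = "\<Sum>a\<in>V. \<Sum>b\<in>V. w a b * J (2 * g a) (2 * g b)"
  have "(lhs has_integral ?r * ((\<Sum>v\<in>V. c v * J 0 (g v)) - ?J1 - ?J2)) UNIV"
    unfolding lhs_def
    by (intro has_integral_mult_right has_integral_diff has_integral_sum finite_V iJ)
  moreover have "(rhs has_integral (\<Sum>a\<in>V. \<Sum>b\<in>V. w a b * I a b) / 2) UNIV"
    unfolding rhs_def
    by (intro has_integral_divide has_integral_mult_right has_integral_sum finite_V UI(1))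
  ultimately have "?r * ((\<Sum>v\<in>V. c v * J 0 (g v)) - ?J1 - ?J2) \<le> (\<Sum>a\<in>V. \<Sum>b\<in>V. w a b * I a b) / 2"
    using pointwise by (rule has_integral_le)
  also have "\<dots> \<le> (\<Sum>a\<in>V. \<Sum>b\<in>V. w a b * (12 * (g a - g b)\<^sup>2)) / 2"
    using UI(2) by (intro divide_right_mono sum_mono mult_left_mono) (auto simp: w_nonneg)
  also have "\<dots> = 12 * energy g"
    by (simp add: energy_eq sum_distrib_left mult.left_commute)
  finally have int: "?r * ((\<Sum>v\<in>V. c v * J 0 (g v)) - ?J1 - ?J2) \<le> 12 * energy g" .
  have J0: "(\<Sum>v\<in>V. c v * J 0 (g v)) = S / 2"
    unfolding S_def sum_divide_distrib using g by (intro sum.cong) (auto simp: J_def)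
  have "?J1 + ?J2 \<le> (\<Sum>a\<in>V. \<Sum>b\<in>V. w a b * (50 * (g a - g b)\<^sup>2 + ((g a)\<^sup>2 + (g b)\<^sup>2) / 16))"
    unfolding sum.distrib[symmetric] distrib_left[symmetric]
  proof (intro sum_mono mult_left_mono)
    fix a b assume "a \<in> V" "b \<in> V"
    \<comment> \<open>The doubled arguments contribute a factor 4, so both terms together are at
      most \<open>5 / 2\<close> times the difference of squares. Applied to
      \<open>square_diff_bound\<close> this yields 50 and \<open>1 / 16\<close>.\<close>
    have "J (g b) (g a) \<le> \<bar>(g a)\<^sup>2 - (g b)\<^sup>2\<bar> / 2" "J (2 * g a) (2 * g b) \<le> 2 * \<bar>(g a)\<^sup>2 - (g b)\<^sup>2\<bar>"
      by (auto simp: J_def power_mult_distrib abs_if)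
    moreover have "j1 + j2 \<le> 50 * q + s / 16" if "j1 \<le> D / 2" "j2 \<le> 2 * D" "D \<le> 20 * q + s / 40"
      for j1 j2 D q s :: real using that by linarith
    ultimately show "J (g b) (g a) + J (2 * g a) (2 * g b) \<le> 50 * (g a - g b)\<^sup>2 + ((g a)\<^sup>2 + (g b)\<^sup>2) / 16"
      using square_diff_bound by blast
  qed (simp add: w_nonneg)
  also have "\<dots> = 100 * energy g + S / 8"
  proof -
    have "(\<Sum>a\<in>V. \<Sum>b\<in>V. w a b * (50 * (g a - g b)\<^sup>2 + ((g a)\<^sup>2 + (g b)\<^sup>2) / 16))
       = 50 * (\<Sum>a\<in>V. \<Sum>b\<in>V. w a b * (g a - g b)\<^sup>2) + (\<Sum>a\<in>V. \<Sum>b\<in>V. w a b * ((g a)\<^sup>2 + (g b)\<^sup>2)) / 16"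
      unfolding sum_distrib_left sum_divide_distrib sum.distrib[symmetric]
      by (intro sum.cong refl) (simp add: field_simps)
    then show ?thesis by (simp add: sum_edges_square energy_eq S_def)
  qed
  \<comment> \<open>The threshold \<open>1 / 800\<close> is chosen to make
    \<open>100 * energy g\<close> at most \<open>S / 8\<close>.\<close>
  also have "\<dots> \<le> S / 4"
  proof -
    have "l * S \<le> 1 / 800 * S" using l S by (intro mult_right_mono) (auto simp: S_def)
    then show ?thesis using E by (simp add: S_def)
  qed
  finally have "S / 4 \<le> S / 2 - ?J1 - ?J2" by simp
  then have "?r * (S / 4) \<le> ?r * (S / 2 - ?J1 - ?J2)" using r by (intro mult_left_mono)
  also have "\<dots> \<le> 12 * (l * S)" using int E by (simp add: J0 S_def)
  finally have "?r * S \<le> 48 * l * S" by simp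
  then show ?thesis using S by (simp add: S_def)
qed

section \<open>Signs of eigenfunctions\<close>

lemma eigenfunction_positive_part:
  assumes f: "eigenfunction \<mu> f"
  defines "g \<equiv> \<lambda>v. max 0 (f v)"
  shows "energy g \<le> \<mu> * (\<Sum>v\<in>V. c v * (g v)\<^sup>2)"
proof -
  have "energy g \<le> dform g f"
    unfolding dform_def
  proof (intro divide_right_mono sum_mono)
    fix u v assume "u \<in> V" "v \<in> V"
    \<comment> \<open>The map \<open>max 0\<close> is monotone and 1-Lipschitz, so the increments of
      \<open>g\<close> and \<open>f\<close> agree in sign and those of \<open>g\<close> are no
      larger in size.\<close>
    moreover have "(g u - g v) * (g u - g v) \<le> (g u - g v) * (f u - f v)"
      by (auto simp: g_def max_def mult_le_0_iff algebra_simps)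
    ultimately show "w u v * ((g u - g v) * (g u - g v)) \<le> w u v * ((g u - g v) * (f u - f v))"
      by (simp add: mult_left_mono w_nonneg)
  qed simp
  also have "\<dots> = \<mu> * (\<Sum>v\<in>V. c v * (g v * f v))" by (rule eigenfunction_dform[OF f])
  also have "(\<Sum>v\<in>V. c v * (g v * f v)) = (\<Sum>v\<in>V. c v * (g v)\<^sup>2)"
    by (intro sum.cong) (auto simp: g_def max_def power2_eq_square)
  finally show ?thesis .
qed

lemma eigenfunction_sum_zero:
  assumes "eigenfunction \<mu> f" "\<mu> \<noteq> 0"
  shows "(\<Sum>v\<in>V. c v * f v) = 0"
  using eigenfunction_dform[OF assms(1), of "\<lambda>_. 1"] assms(2) by (simp add: dform_def)

lemma eigenfunction_uminus:
  assumes "eigenfunction \<mu> f"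
  shows "eigenfunction \<mu> (\<lambda>v. - f v)"
proof -
  have "lap (\<lambda>v. - f v) v = - lap f v" for v
    unfolding lap_def sum_negf[symmetric] by (intro sum.cong) (auto simp: algebra_simps)
  then show ?thesis using assms by (simp add: eigenfunction_def)
qed

text \<open>Orthogonality to constants gives weighted mean zero, so a nonpositive eigenfunction
  would vanish.\<close>

lemma eigenfunction_pos_value:
  assumes "eigenfunction \<mu> f" "\<mu> \<noteq> 0"
  shows "\<exists>v\<in>V. 0 < f v"
proof (rule ccontr)
  assume "\<not> ?thesis"
  then have le: "\<And>v. v \<in> V \<Longrightarrow> f v \<le> 0" by force
  have "(\<Sum>v\<in>V. c v * - f v) = 0"
    using eigenfunction_sum_zero[OF assms] by (simp add: sum_negf)
  then have "\<forall>v\<in>V. c v * - f v = 0"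
    using le by (subst (asm) sum_nonneg_eq_0_iff) (auto intro!: mult_nonneg_nonpos simp: less_imp_le[OF c_pos])
  then have "\<forall>v\<in>V. f v = 0" using c_pos by fastforce
  then show False using assms(1) by (auto simp: eigenfunction_def)
qed

text \<open>Of \<open>f\<close> and \<open>- f\<close>, the one whose positive set has the smaller
  volume is taken. The bound uses the set where the function is nonpositive, which is the zero set
  of its positive part.\<close>

lemma exists_oriented_eigenfunction:
  assumes "eigenfunction \<mu> f"
  shows "\<exists>f. eigenfunction \<mu> f \<and> vol G {v \<in> V. 0 < f v} \<le> vol G {v \<in> V. f v \<le> 0}"
proof -
  have neg: "vol G {v \<in> V. h v < 0} \<le> vol G {v \<in> V. h v \<le> 0}" for h :: "'a \<Rightarrow> real"
    unfolding vol_def by (intro sum_mono2) (auto simp: less_imp_le[OF c_pos])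
  show ?thesis
  proof (cases "vol G {v \<in> V. 0 < f v} \<le> vol G {v \<in> V. f v < 0}")
    case True
    then show ?thesis using assms neg[of f] by (intro exI[of _ f]) auto
  next
    case False
    then show ?thesis using eigenfunction_uminus[OF assms] neg[of "\<lambda>v. - f v"]
      by (intro exI[of _ "\<lambda>v. - f v"]) auto
  qed
qed

section \<open>Comparison of \<open>rho_graph\<close> with \<open>lambda_graph\<close>\<close>

lemma rho_graph_nonneg: "0 \<le> rho_graph G"
proof -
  \<comment> \<open>The general lower bound with \<open>l = 0\<close>.\<close>
  have "\<exists>m. 0 * (\<Sum>v\<in>V. c v * (f v - m)\<^sup>2) \<le> energy f" for f
    using energy_nonneg by simp
  from rho_graph_ge[OF this] show ?thesis by simp
qed

lemma lambda_graph_le_rho_graph: "lambda_graph G / 2 \<le> rho_graph G"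
  using lambda_graph_poincare lambda_graph_pos by (intro rho_graph_ge) (auto simp: less_imp_le)

text \<open>Below the threshold \<open>1 / 800\<close> the sweep gives even the factor 48; above it
  the bound 1 from two single vertices is less than \<open>800 * lambda_graph G\<close>.\<close>

lemma rho_graph_le_lambda_graph: "rho_graph G \<le> 800 * lambda_graph G"
proof (cases "lambda_graph G \<le> 1 / 800")
  case True
  let ?l = "lambda_graph G"
  obtain f where f: "eigenfunction ?l f"
    and vol: "vol G {v \<in> V. 0 < f v} \<le> vol G {v \<in> V. f v \<le> 0}"
    using lambda_graph_eigenfunction exists_oriented_eigenfunction by blast
  define g where "g v = max 0 (f v)" for v
  obtain a where a: "a \<in> V" "0 < f a"
    using eigenfunction_pos_value[OF f] lambda_graph_pos by auto
  obtain b where b: "b \<in> V" "0 < - f b"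
    using eigenfunction_pos_value[OF eigenfunction_uminus[OF f]] lambda_graph_pos by auto
  have sets: "{v \<in> V. 0 < g v} = {v \<in> V. 0 < f v}" "{v \<in> V. g v = 0} = {v \<in> V. f v \<le> 0}"
    by (auto simp: g_def max_def split: if_splits)
  have "rho_graph G \<le> 48 * ?l"
  proof (rule sweep_bound[of g])
    show "0 < (\<Sum>v\<in>V. c v * (g v)\<^sup>2)"
      using a c_pos by (intro sum_pos2[of V a]) (auto simp: g_def less_imp_le[OF c_pos])
    show "energy g \<le> ?l * (\<Sum>v\<in>V. c v * (g v)\<^sup>2)"
      using eigenfunction_positive_part[OF f] by (simp add: g_def[abs_def])
    show "\<exists>v\<in>V. g v = 0" using b by (auto simp: g_def intro!: bexI[of _ b])
  qed (use vol True rho_graph_nonneg in \<open>auto simp: sets\<close>, auto simp: g_def)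
  then show ?thesis using lambda_graph_pos by simp
next
  case False
  then show ?thesis using rho_graph_le_1 by simp
qed

end

theorem theorem1p2:
  fixes G :: "'a wgraph"
  assumes "weighted_graph G"
    and "connected_graph G"
    and "card (verts G) \<ge> 2"
  shows "lambda_graph G / 2 \<le> rho_graph G \<and> rho_graph G \<le> 25600 * lambda_graph G"
proof -
  interpret connected_weighted_graph G
    using assms by unfold_locales
  \<comment> \<open>Positivity of \<open>lambda_graph G\<close> weakens the constant 800 to
    25600.\<close>
  show ?thesis
    using lambda_graph_le_rho_graph rho_graph_le_lambda_graph lambda_graph_pos by auto
qed

end
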